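(* Let $G$ be the plane Gaussian analytic function and let $\tau$ be a complex number with $|\tau|<1$. Then the random holomorphic function $V_\tau G$ given by $$(V_{\tau}G)(z)=\left(1-|\tau|^{2}\right)^{1/4} e^{\bar\tau z^{2}/2}\left(e^{-\tau D^{2}/2}G\right)\left(z\sqrt{1-|\tau|^{2}}\right),\qquad z\in\mathbb{C},$$ is well defined and has the same distribution as $G$. In particular, we have the equality in distribution of the collections of zeros $$\frac{\mathcal{Z}(e^{-\tau D^{2}/2}G)}{\sqrt{1-|\tau|^{2}}}=\mathcal{Z}(V_\tau G)\stackrel{d}{=}\mathcal{Z}(G).$$
   Context: The (plane, flat) Gaussian analytic function (GAF) is the random entire function $G(z)=\sum_{n=0}^\infty \xi_n \frac{z^n}{\sqrt{n!}}$, where $\xi_0,\xi_1,\dots$ are i.i.d. standard complex Gaussian random variables (density $\pi^{-1}e^{-|z|^2}$ on $\mathbb{C}$). Equivalently it is the centered complex Gaussian random entire function with $\mathbb{E}[G(z)\overline{G(w)}]=e^{z\bar w}$. $D=d/dz$, and for an entire function $F$ and $\tau\in\mathbb{C}$ the heat-flow operator is $e^{-\tau D^2/2}F(z)=\sum_{k=0}^\infty \frac{1}{k!}\left(\frac{-\tau}{2}\right)^k D^{2k}F(z)$ whenever the series converges. $\mathcal{Z}(F)$ is the collection of zeros of $F$ (counted with multiplicity, identified with the point process $\sum_{z\in\mathcal{Z}(F)}\delta_z$), and for $a\in\mathbb{C}$, $a\cdot\mathcal{Z}(F)=\{az: z\in\mathcal{Z}(F)\}$. *)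

theory Defs
  imports "HOL-Probability.Probability" "HOL-Complex_Analysis.Complex_Analysis"
begin

section \<open>The plane Gaussian analytic function\<close>

text \<open>
  Since \<open>lborel\<close> on the complex numbers is planar Lebesgue measure, the density is the one of the
  standard complex Gaussian law, for which the second absolute moment equals 1.
\<close>

definition iid_std_complex_gaussian :: "'a measure \<Rightarrow> (nat \<Rightarrow> 'a \<Rightarrow> complex) \<Rightarrow> bool" where
  "iid_std_complex_gaussian M \<xi> \<longleftrightarrow>
     prob_space.indep_vars M (\<lambda>_. borel) \<xi> UNIV \<and>
     (\<forall>n. distributed M lborel (\<xi> n) (\<lambda>z. ennreal (exp (- (cmod z)\<^sup>2) / pi)))"

definition gaf :: "(nat \<Rightarrow> 'a \<Rightarrow> complex) \<Rightarrow> 'a \<Rightarrow> complex \<Rightarrow> complex" where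
  "gaf \<xi> \<omega> z = (\<Sum>n. \<xi> n \<omega> * (z ^ n / of_real (sqrt (fact n))))"

section \<open>Heat flow\<close>

definition heat_term :: "complex \<Rightarrow> (complex \<Rightarrow> complex) \<Rightarrow> complex \<Rightarrow> nat \<Rightarrow> complex" where
  "heat_term \<tau> F z k = 1 / fact k * (- \<tau> / 2) ^ k * (deriv ^^ (2 * k)) F z"

text \<open>The operator \<open>exp (- \<tau> D\<^sup>2 / 2)\<close>; meaningful where \<open>heat_term \<tau> F z\<close> is summable.\<close>

definition heat_flow :: "complex \<Rightarrow> (complex \<Rightarrow> complex) \<Rightarrow> complex \<Rightarrow> complex" where
  "heat_flow \<tau> F z = (\<Sum>k. heat_term \<tau> F z k)"

definition V_op :: "complex \<Rightarrow> (complex \<Rightarrow> complex) \<Rightarrow> complex \<Rightarrow> complex" where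
  "V_op \<tau> F z =
     of_real ((1 - (cmod \<tau>)\<^sup>2) powr (1 / 4)) * exp (cnj \<tau> * z\<^sup>2 / 2) *
     heat_flow \<tau> F (z * of_real (sqrt (1 - (cmod \<tau>)\<^sup>2)))"

section \<open>Random entire functions and point processes\<close>

text \<open>
  Entire functions with the Borel \<open>\<sigma>\<close>-algebra of the topology of uniform convergence on compact
  sets.
\<close>

definition open_entire :: "(complex \<Rightarrow> complex) set \<Rightarrow> bool" where
  "open_entire U \<longleftrightarrow> U \<subseteq> {f. f holomorphic_on UNIV} \<and>
     (\<forall>f\<in>U. \<exists>K e. compact K \<and> e > 0 \<and>
        {g. g holomorphic_on UNIV \<and> (\<forall>z\<in>K. dist (g z) (f z) < e)} \<subseteq> U)"

definition entire_borel :: "(complex \<Rightarrow> complex) measure" where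
  "entire_borel = sigma {f. f holomorphic_on UNIV} (Collect open_entire)"

text \<open>
  Point configurations with multiplicities, as locally finite integer-valued measures. As for
  \<^const>\<open>subprob_algebra\<close>, the \<open>\<sigma>\<close>-algebra is the one generated by all counting maps
  \<open>\<mu> \<mapsto> \<mu> B\<close>, \<open>B\<close> a Borel set.
\<close>

definition point_configurations :: "complex measure measure" where
  "point_configurations =
     (SUP B\<in>sets borel. vimage_algebra
        {\<mu>. sets \<mu> = sets borel \<and>
            (\<forall>A\<in>sets borel. bounded A \<longrightarrow> (\<exists>n::nat. emeasure \<mu> A = of_nat n))}
        (\<lambda>\<mu>. emeasure \<mu> B) borel)"

text \<open>
  The zero collection as the measure that is the sum of the Dirac measures at the zeros, each
  weighted by its multiplicity \<^const>\<open>zorder\<close>. For the zero function, \<^const>\<open>zorder\<close> is unspecified.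
\<close>

definition zero_process :: "(complex \<Rightarrow> complex) \<Rightarrow> complex measure" where
  "zero_process F =
     distr (point_measure {z. F z = 0} (\<lambda>z. of_nat (nat (zorder F z)))) borel (\<lambda>z. z)"

definition scale_process :: "complex \<Rightarrow> complex measure \<Rightarrow> complex measure" where
  "scale_process a \<mu> = distr \<mu> borel (\<lambda>z. a * z)"

text \<open>
  Equality in distribution of two almost surely defined random elements of \<open>N\<close>: both agree almost
  surely with genuine (measurable, everywhere \<open>N\<close>-valued) random elements, and these have the
  same law. The law does not depend on the choice of the versions.
\<close>

definition eq_in_law :: "'a measure \<Rightarrow> 'b measure \<Rightarrow> ('a \<Rightarrow> 'b) \<Rightarrow> ('a \<Rightarrow> 'b) \<Rightarrow> bool" where
  "eq_in_law M N X Y \<longleftrightarrow>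
     (\<exists>X'\<in>measurable M N. \<exists>Y'\<in>measurable M N.
        (AE \<omega> in M. X \<omega> = X' \<omega>) \<and> (AE \<omega> in M. Y \<omega> = Y' \<omega>) \<and> distr M N X' = distr M N Y')"

end

theory Submission
  imports Defs
begin

text \<open>
  Almost surely the coefficients satisfy \<open>\<bar>\<xi>\<^sub>n\<bar> \<le> C (n + 1)\<close>, and then all double series
  converge absolutely, so that \<open>V\<^sub>\<tau> G = (\<Sum>n. \<xi>\<^sub>n \<psi>\<^sub>n)\<close> with
  \<open>\<psi>\<^sub>n = V\<^sub>\<tau> (z \<mapsto> z\<^sup>n / sqrt (n!))\<close>. Mehler's formula for the polynomials
  \<open>exp (- \<tau> D\<^sup>2 / 2) z\<^sup>n\<close> shows that \<open>\<Sum>n. \<psi>\<^sub>n(z) cnj (\<psi>\<^sub>n(w))\<close> is again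
  the covariance kernel \<open>exp (z cnj w)\<close>; hence both series have the same joint characteristic
  functions, the same finite-dimensional distributions, and the same law, because point evaluations
  generate the Borel sets of the space of entire functions (rational polynomials are dense).
  The zeros follow by measurability: by Rouche's theorem the number of zeros in a bounded open
  set is a lower semicontinuous function of the entire function.
\<close>

section \<open>Gaussian integrals and Mehler's formula\<close>

text \<open>The obstacle is that sqrt ((2k)!) / (2^k k!) decays only like a power of k, so with
  coefficients of size about 1 / sqrt (n!) the heat series has barely geometric decay |\<tau>|^k. To
  reach the whole disc |\<tau>| < 1, the bound on the double series may lose only geometric factors
  arbitrarily close to 1. The growth bound on the coefficients comes from their finite second
  moment, and it is the only probabilistic input to convergence. The covariance kernel suffices
  because of circular symmetry: the characteristic function of Re (\<Sum> \<beta>_n \<xi>_n) depends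
  only on \<Sum> |\<beta>_n|^2, so E[G(z) G(w)] never has to be considered. The factor (1 -
  |\<tau>|^2)^(1/4), the exponential and the rescaling by sqrt (1 - |\<tau>|^2) in
  \<open>V_op\<close> are exactly what turns Mehler's kernel into exp (z cnj w). Joint laws are
  recovered from Levy's theorem on the line alone, one coordinate at a time; the coordinates already
  treated survive as weights.\<close>

lemma std_normal_exp:
  fixes \<beta> :: complex
  shows "has_bochner_integral lborel (\<lambda>x. std_normal_density x *\<^sub>R exp (\<beta> * of_real x)) (exp (\<beta>\<^sup>2 / 2))"
proof -
  define p q where "p = Re \<beta>" and "q = Im \<beta>"
  have b: "\<beta> = of_real p + \<i> * of_real q" by (simp add: p_def q_def complex_eq)
  interpret real_distribution std_normal_distribution by (rule real_dist_normal_dist)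
  have "integrable std_normal_distribution (\<lambda>x. iexp (q * x))"
    by (rule integrable_iexp) auto
  moreover have "(\<integral>x. iexp (q * x) \<partial>std_normal_distribution) = of_real (exp (- q\<^sup>2 / 2))"
    using fun_cong[OF char_std_normal_distribution, of q] by (simp add: char_def)
  ultimately have "has_bochner_integral std_normal_distribution (\<lambda>x. iexp (q * x)) (of_real (exp (- q\<^sup>2 / 2)))"
    by (simp add: has_bochner_integral_iff)
  then have "has_bochner_integral lborel (\<lambda>x. std_normal_density x *\<^sub>R iexp (q * x)) (of_real (exp (- q\<^sup>2 / 2)))"
    by (auto simp: has_bochner_integral_iff integrable_density integral_density)
  \<comment> \<open>Completing the square: the real part \<open>p\<close> of \<beta> is produced by
    a real translation of the variable in the characteristic function, so no contour has to be
    moved.\<close>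
  then have "has_bochner_integral lborel (\<lambda>x. std_normal_density (- p + 1 * x) *\<^sub>R iexp (q * (- p + 1 * x))) (of_real (exp (- q\<^sup>2 / 2)) /\<^sub>R \<bar>1\<bar>)"
    by (subst (asm) lborel_has_bochner_integral_real_affine_iff[of 1 _ _ "- p"]) auto
  then have "has_bochner_integral lborel (\<lambda>x. exp (of_real (p\<^sup>2/2) + \<i> * p * q) * (std_normal_density (x - p) *\<^sub>R iexp (q * (x - p))))
     (exp (of_real (p\<^sup>2/2) + \<i> * p * q) * of_real (exp (- q\<^sup>2 / 2)))"
    by (intro has_bochner_integral_mult_right) simp
  moreover have "exp (of_real (p\<^sup>2/2) + \<i> * p * q) * (std_normal_density (x - p) *\<^sub>R iexp (q * (x - p)))
      = std_normal_density x *\<^sub>R exp (\<beta> * of_real x)" for x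
    unfolding std_normal_density_def b scaleR_conv_of_real
    by (simp add: exp_of_real[symmetric] mult_exp_exp power2_eq_square field_simps)
      (rule arg_cong[where f = exp], simp add: field_simps)
  moreover have "exp (of_real (p\<^sup>2/2) + \<i> * p * q) * of_real (exp (- q\<^sup>2 / 2)) = exp (\<beta>\<^sup>2 / 2)"
    unfolding b by (simp add: exp_of_real[symmetric] mult_exp_exp power2_eq_square field_simps)
      (rule arg_cong[where f = exp], simp add: field_simps)
  ultimately show ?thesis by simp
qed

text \<open>The factor exp (g x^2 / 2) changes the variance from 1 to 1 / (1 - g), so the
  substitution x -> s x with s = 1 / sqrt (1 - g) leads back to \<open>std_normal_exp\<close>. The
  case g = |\<tau>|^2 serves Mehler's formula, g = -1 the density of the real and imaginary parts of
  \<xi>.\<close>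

lemma std_normal_exp_quadratic:
  fixes \<beta> :: complex and g :: real
  assumes g: "g < 1"
  shows "has_bochner_integral lborel (\<lambda>x. std_normal_density x *\<^sub>R exp (\<beta> * of_real x + of_real (g * x\<^sup>2 / 2)))
           (of_real (1 / sqrt (1 - g)) * exp (\<beta>\<^sup>2 / (2 * of_real (1 - g))))"
proof -
  define s where "s = 1 / sqrt (1 - g)"
  have s: "s > 0" "s\<^sup>2 * (1 - g) = 1" using g by (auto simp: s_def power_divide)
  have s2: "s\<^sup>2 = 1 / (1 - g)" using g by (auto simp: s_def power_divide)
  have "has_bochner_integral lborel (\<lambda>x. std_normal_density x *\<^sub>R exp (\<beta> * s * of_real x)) (exp ((\<beta> * s)\<^sup>2 / 2))"
    by (rule std_normal_exp)
  moreover have "std_normal_density x *\<^sub>R exp (\<beta> * s * of_real x)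
     = std_normal_density (s * x) *\<^sub>R exp (\<beta> * of_real (s * x) + of_real (g * (s * x)\<^sup>2 / 2))" for x
  proof -
    have "x\<^sup>2 = s\<^sup>2 * (1 - g) * x\<^sup>2" using s by simp
    then have "- x\<^sup>2 / 2 = - (s*x)\<^sup>2 / 2 + g * (s * x)\<^sup>2 / 2" by (simp add: power_mult_distrib algebra_simps)
    then have "exp (- x\<^sup>2 / 2) = exp (- (s*x)\<^sup>2 / 2) * exp (g * (s * x)\<^sup>2 / 2)"
      by (simp add: mult_exp_exp)
    then have "std_normal_density x = std_normal_density (s * x) * exp (g * (s * x)\<^sup>2 / 2)"
      by (simp add: std_normal_density_def)
    then show ?thesis
      by (simp add: exp_add exp_of_real scaleR_conv_of_real mult_ac del: of_real_power of_real_mult of_real_divide) (simp add: mult_ac)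
  qed
  ultimately have "has_bochner_integral lborel (\<lambda>x. std_normal_density (0 + s * x) *\<^sub>R exp (\<beta> * of_real (0 + s * x) + of_real (g * (0 + s * x)\<^sup>2 / 2))) ((s *\<^sub>R exp ((\<beta> * s)\<^sup>2 / 2)) /\<^sub>R \<bar>s\<bar>)"
    using s by (simp del: of_real_mult)
  then have "has_bochner_integral lborel (\<lambda>x. std_normal_density x *\<^sub>R exp (\<beta> * of_real x + of_real (g * x\<^sup>2 / 2))) (s *\<^sub>R exp ((\<beta> * s)\<^sup>2 / 2))"
    using s by (subst lborel_has_bochner_integral_real_affine_iff[of s _ _ 0]) auto
  moreover have "(\<beta> * s)\<^sup>2 / 2 = \<beta>\<^sup>2 / (2 * of_real (1 - g))"
    using s2 by (simp add: power_mult_distrib flip: of_real_power)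
  ultimately show ?thesis unfolding s_def scaleR_conv_of_real by (simp only:)
qed

text \<open>Source of the dominating functions when sums and Gaussian integrals are exchanged; exp
  (b |x|) is at most exp (b x) + exp (- b x).\<close>

lemma integrable_std_normal_exp_abs:
  fixes b g :: real
  assumes "g < 1"
  shows "integrable lborel (\<lambda>x. std_normal_density x * exp (b * \<bar>x\<bar> + g * x\<^sup>2 / 2))"
proof -
  have *: "integrable lborel (\<lambda>x. std_normal_density x * exp (c * x + g * x\<^sup>2 / 2))" for c
  proof -
    have "norm (std_normal_density x *\<^sub>R exp (of_real c * of_real x + of_real (g * x\<^sup>2 / 2)) :: complex)
        = std_normal_density x * exp (c * x + g * x\<^sup>2 / 2)" for x
      by (simp add: norm_exp_eq_Re)
    then show ?thesis
      using integrable_norm[OF integrable.intros[OF std_normal_exp_quadratic[OF assms, of "of_real c"]]]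
      by simp
  qed
  show ?thesis
  proof (rule Bochner_Integration.integrable_bound)
    show "integrable lborel (\<lambda>x. std_normal_density x * exp (b * x + g * x\<^sup>2 / 2) + std_normal_density x * exp ((- b) * x + g * x\<^sup>2 / 2))"
      by (intro Bochner_Integration.integrable_add *)
    have "exp (b * \<bar>x\<bar> + g * x\<^sup>2 / 2) \<le> exp (b * x + g * x\<^sup>2 / 2) + exp ((- b) * x + g * x\<^sup>2 / 2)" for x
      by (cases "x \<ge> 0") auto
    then have "std_normal_density x * exp (b * \<bar>x\<bar> + g * x\<^sup>2 / 2)
        \<le> std_normal_density x * exp (b * x + g * x\<^sup>2 / 2) + std_normal_density x * exp ((- b) * x + g * x\<^sup>2 / 2)" for x
      by (simp add: mult_left_mono flip: distrib_left)
    then show "AE x in lborel. norm (std_normal_density x * exp (b * \<bar>x\<bar> + g * x\<^sup>2 / 2))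
        \<le> norm (std_normal_density x * exp (b * x + g * x\<^sup>2 / 2) + std_normal_density x * exp ((- b) * x + g * x\<^sup>2 / 2))"
      by (simp add: add_nonneg_nonneg abs_mult)
  qed measurable
qed

lemma sums_integral_dominated:
  fixes f :: "nat \<Rightarrow> 'a \<Rightarrow> complex"
  assumes f: "\<And>n. has_bochner_integral M (f n) (c n)"
    and s: "\<And>x. (\<lambda>n. f n x) sums s x"
    and w: "integrable M w" "\<And>N x. (\<Sum>n<N. norm (f n x)) \<le> w x"
  shows "c sums (\<integral>x. s x \<partial>M)"
proof -
  have [measurable]: "f n \<in> borel_measurable M" for n
    using f[of n] by (auto simp: has_bochner_integral_iff)
  have "(\<lambda>N. \<integral>x. (\<Sum>n<N. f n x) \<partial>M) \<longlonglongrightarrow> (\<integral>x. s x \<partial>M)"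
  proof (rule integral_dominated_convergence[OF _ _ w(1)])
    show "AE x in M. (\<lambda>N. \<Sum>n<N. f n x) \<longlonglongrightarrow> s x"
      using s by (auto simp: sums_def)
    show "AE x in M. norm (\<Sum>n<N. f n x) \<le> w x" for N
      by (intro always_eventually allI order.trans[OF norm_sum w(2)])
    have "s = (\<lambda>x. \<Sum>n. f n x)" using s by (auto simp: sums_iff)
    then show "s \<in> borel_measurable M" by simp
  qed measurable
  moreover have "(\<integral>x. (\<Sum>n<N. f n x) \<partial>M) = (\<Sum>n<N. c n)" for N
    using f by (subst Bochner_Integration.integral_sum) (auto simp: has_bochner_integral_iff)
  ultimately show ?thesis by (simp add: sums_def)
qed

text \<open>This is exp (- \<tau> D^2 / 2) applied to u^n; the series stops because D^(2k) u^n = 0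
  for 2k > n. For \<tau> = 1 these are the probabilists' Hermite polynomials.\<close>

definition heat_monomial :: "complex \<Rightarrow> nat \<Rightarrow> complex \<Rightarrow> complex" where
  "heat_monomial \<tau> n u =
     (\<Sum>k\<le>n div 2. 1 / fact k * (- \<tau> / 2) ^ k * (fact n / fact (n - 2 * k)) * u ^ (n - 2 * k))"

lemma std_normal_moment:
  "has_bochner_integral lborel (\<lambda>x. std_normal_density x *\<^sub>R (of_real x :: complex) ^ j)
     (if even j then of_real (fact j / (2 ^ (j div 2) * fact (j div 2))) else 0)"
proof -
  have "has_bochner_integral lborel (\<lambda>x. std_normal_density x * x ^ j)
     (if even j then fact j / (2 ^ (j div 2) * fact (j div 2)) else 0)"
    using std_normal_moment_even[of "j div 2"] std_normal_moment_odd[of "j div 2"]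
    by (cases "even j") auto
  then have "has_bochner_integral lborel (\<lambda>x. of_real (std_normal_density x * x ^ j) :: complex)
     (of_real (if even j then fact j / (2 ^ (j div 2) * fact (j div 2)) else 0))"
    by (rule has_bochner_integral_of_real)
  then show ?thesis
    by (simp add: scaleR_conv_of_real if_distrib[of of_real] cong: if_cong)
qed

text \<open>The heat flow as a Gaussian average: exp (a^2 D^2 / 2) p is the mean of p (u + a X) for
  a standard normal X. For polynomials this is an identity of moments, so a complex \<open>a\<close>
  is harmless; odd moments vanish and the even ones give the coefficients.\<close>

lemma heat_monomial_eq_integral:
  assumes a: "a\<^sup>2 = - \<tau>"
  shows "has_bochner_integral lborel (\<lambda>x. std_normal_density x *\<^sub>R (u + a * of_real x) ^ n) (heat_monomial \<tau> n u)"
proof -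
  let ?m = "\<lambda>j. if even j then of_real (fact j / (2 ^ (j div 2) * fact (j div 2))) else (0::complex)"
  let ?c = "\<lambda>j. of_nat (n choose j) * a ^ j * u ^ (n - j)"
  have "has_bochner_integral lborel (\<lambda>x. \<Sum>j\<le>n. ?c j * (std_normal_density x *\<^sub>R of_real x ^ j)) (\<Sum>j\<le>n. ?c j * ?m j)"
    by (intro has_bochner_integral_sum has_bochner_integral_mult_right std_normal_moment)
  moreover have "(\<Sum>j\<le>n. ?c j * (std_normal_density x *\<^sub>R of_real x ^ j)) = std_normal_density x *\<^sub>R (u + a * of_real x) ^ n" for x
    by (subst add.commute, subst binomial_ring) (simp add: scaleR_conv_of_real sum_distrib_left power_mult_distrib mult_ac)
  moreover have "(\<Sum>j\<le>n. ?c j * ?m j) = (\<Sum>j\<in>(\<lambda>k. 2 * k) ` {..n div 2}. ?c j * ?m j)"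
    by (rule sum.mono_neutral_right) (auto elim!: evenE)
  moreover have "\<dots> = (\<Sum>k\<le>n div 2. ?c (2*k) * ?m (2*k))"
    by (subst sum.reindex) (auto simp: inj_on_def)
  moreover have "\<dots> = heat_monomial \<tau> n u"
    unfolding heat_monomial_def
  proof (rule sum.cong[OF refl])
    fix k assume "k \<in> {..n div 2}"
    then have k: "2 * k \<le> n" by auto
    have "a ^ (2 * k) = (- \<tau>) ^ k" by (simp add: power_mult a)
    moreover have "(- \<tau> / 2) ^ k = (- \<tau>) ^ k / 2 ^ k" by (rule power_divide)
    ultimately show "?c (2*k) * ?m (2*k) = 1 / fact k * (- \<tau> / 2) ^ k * (fact n / fact (n - 2 * k)) * u ^ (n - 2 * k)"
      using k by (simp add: binomial_fact mult_ac)
  qed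
  ultimately show ?thesis by simp
qed

text \<open>By linearity this is exp (- \<tau> D^2 / 2) applied to the eigenfunction exp (t v). The
  proof averages the exponential series of t (v + a X) over X.\<close>

lemma heat_monomial_generating_function:
  "(\<lambda>n. heat_monomial \<tau> n v * t ^ n / fact n) sums exp (t * v - \<tau> * t\<^sup>2 / 2)"
proof -
  define a where "a = csqrt (- \<tau>)"
  have a: "a\<^sup>2 = - \<tau>" by (simp add: a_def)
  let ?f = "\<lambda>n x. std_normal_density x *\<^sub>R (v + a * of_real x) ^ n * (t ^ n / fact n)"
  have "(\<lambda>n. heat_monomial \<tau> n v * (t ^ n / fact n)) sums
     (\<integral>x. std_normal_density x *\<^sub>R exp (t * (v + a * of_real x)) \<partial>lborel)"
  proof (rule sums_integral_dominated[where f = ?f])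
    show "has_bochner_integral lborel (?f n) (heat_monomial \<tau> n v * (t ^ n / fact n))" for n
      by (intro has_bochner_integral_mult_left heat_monomial_eq_integral a)
    show "(\<lambda>n. ?f n x) sums (std_normal_density x *\<^sub>R exp (t * (v + a * of_real x)))" for x
    proof -
      have "(\<lambda>n. std_normal_density x *\<^sub>R ((t * (v + a * of_real x)) ^ n /\<^sub>R fact n)) sums (std_normal_density x *\<^sub>R exp (t * (v + a * of_real x)))"
        by (intro sums_scaleR_right exp_converges)
      moreover have "std_normal_density x *\<^sub>R ((t * (v + a * of_real x)) ^ n /\<^sub>R fact n) = ?f n x" for n
        unfolding power_mult_distrib by (simp add: scaleR_conv_of_real divide_inverse mult_ac)
      ultimately show ?thesis by simp
    qed
    \<comment> \<open>The vanishing quadratic term only gives the majorant the shape of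
      \<open>integrable_std_normal_exp_abs\<close> with g = 0.\<close>
    show "integrable lborel (\<lambda>x. exp (norm t * norm v) * (std_normal_density x * exp (norm t * norm a * \<bar>x\<bar> + 0 * x\<^sup>2 / 2)))"
      by (intro integrable_mult_right integrable_std_normal_exp_abs) auto
    show "(\<Sum>n<N. norm (?f n x)) \<le> exp (norm t * norm v) * (std_normal_density x * exp (norm t * norm a * \<bar>x\<bar> + 0 * x\<^sup>2 / 2))" for N x
    proof -
      let ?y = "norm t * norm (v + a * of_real x)"
      have "(\<Sum>n<N. norm (?f n x)) = std_normal_density x * (\<Sum>n<N. ?y ^ n /\<^sub>R fact n)"
        by (simp add: sum_distrib_left norm_mult norm_divide norm_power power_mult_distrib field_simps)
      also have "\<dots> \<le> std_normal_density x * exp ?y"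
        unfolding exp_def by (intro mult_left_mono sum_le_suminf summable_exp_generic) auto
      also have "?y \<le> norm t * (norm v + norm a * \<bar>x\<bar>)"
        by (intro mult_left_mono order.trans[OF norm_triangle_ineq]) (auto simp: norm_mult)
      finally have "(\<Sum>n<N. norm (?f n x)) \<le> std_normal_density x * exp (norm t * (norm v + norm a * \<bar>x\<bar>))"
        by (simp add: mult_left_mono)
      then show ?thesis
        by (simp add: mult_exp_exp algebra_simps)
    qed
  qed
  also have "(\<integral>x. std_normal_density x *\<^sub>R exp (t * (v + a * of_real x)) \<partial>lborel)
      = (\<integral>x. exp (t * v) * (std_normal_density x *\<^sub>R exp ((t * a) * of_real x)) \<partial>lborel)"
    by (simp add: distrib_left exp_add mult_ac)
  also have "\<dots> = exp (t * v) * exp ((t * a)\<^sup>2 / 2)"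
    by (intro has_bochner_integral_integral_eq has_bochner_integral_mult_right std_normal_exp)
  also have "\<dots> = exp (t * v - \<tau> * t\<^sup>2 / 2)"
    by (simp add: power_mult_distrib a mult_exp_exp mult_ac)
  finally show ?thesis by simp
qed

text \<open>Replacing \<tau> by - |\<tau>| and v by |v| makes all coefficients nonnegative and
  dominates the original ones, so the generating function at these arguments is a majorant.\<close>

lemma sum_norm_heat_monomial_le:
  fixes t :: real
  assumes t: "t \<ge> 0"
  shows "(\<Sum>n<N. norm (heat_monomial \<tau> n v) * t ^ n / fact n) \<le> exp (t * norm v + norm \<tau> * t\<^sup>2 / 2)"
proof -
  define h where "h n = (\<Sum>k\<le>n div 2. 1 / fact k * (norm \<tau> / 2) ^ k * (fact n / fact (n - 2 * k)) * norm v ^ (n - 2 * k))" for n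
  have h_ge0: "h n \<ge> 0" for n by (auto simp: h_def intro!: sum_nonneg)
  have h_ge: "norm (heat_monomial \<tau> n v) \<le> h n" for n
    unfolding heat_monomial_def h_def
    by (rule order.trans[OF norm_sum]) (simp add: norm_mult norm_divide norm_power)
  have h: "heat_monomial (- of_real (norm \<tau>)) n (of_real (norm v)) = of_real (h n)" for n
    by (simp add: heat_monomial_def h_def)
  have "(\<lambda>n. of_real (h n * t ^ n / fact n) :: complex) sums of_real (exp (t * norm v + norm \<tau> * t\<^sup>2 / 2))"
    using heat_monomial_generating_function[of "- of_real (norm \<tau>)" "of_real (norm v)" "of_real t"]
    by (simp add: h exp_of_real[symmetric])
  then have s: "(\<lambda>n. h n * t ^ n / fact n) sums exp (t * norm v + norm \<tau> * t\<^sup>2 / 2)"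
    by (simp only: sums_of_real_iff)
  have "(\<Sum>n<N. norm (heat_monomial \<tau> n v) * t ^ n / fact n) \<le> (\<Sum>n<N. h n * t ^ n / fact n)"
    using t by (intro sum_mono divide_right_mono mult_right_mono h_ge) auto
  also have "\<dots> \<le> (\<Sum>n. h n * t ^ n / fact n)"
    using s t h_ge0 by (intro sum_le_suminf) (auto simp: sums_iff)
  finally show ?thesis using s by (simp add: sums_iff)
qed

text \<open>Mehler's formula: expanding only the first factor as a Gaussian moment leaves the generating
  function of the second one, integrated against a single normal variable.\<close>

lemma heat_monomial_Mehler:
  assumes \<tau>: "norm \<tau> < 1"
  shows "(\<lambda>n. heat_monomial \<tau> n u * cnj (heat_monomial \<tau> n v) / fact n) sums
     (of_real (1 / sqrt (1 - (norm \<tau>)\<^sup>2)) *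
      exp (u * cnj v - cnj \<tau> * u\<^sup>2 / 2 - \<tau> * (cnj v - cnj \<tau> * u)\<^sup>2 / (2 * of_real (1 - (norm \<tau>)\<^sup>2))))"
proof -
  define a where "a = csqrt (- \<tau>)"
  have a: "a\<^sup>2 = - \<tau>" by (simp add: a_def)
  have na: "(norm a)\<^sup>2 = norm \<tau>" using a by (metis norm_minus_cancel norm_power)
  have g: "(norm \<tau>)\<^sup>2 < 1" using \<tau> by (simp add: abs_square_less_1)
  let ?f = "\<lambda>n x. std_normal_density x *\<^sub>R (u + a * of_real x) ^ n * (cnj (heat_monomial \<tau> n v) / fact n)"
  let ?s = "\<lambda>x::real. (u + a * of_real x) * cnj v - cnj \<tau> * (u + a * of_real x)\<^sup>2 / 2"
  \<comment> \<open>\<open>b\<close> and \<open>C\<close> result from expanding |v| y + |\<tau>| y^2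
    / 2 at y = |u| + |a| |x|. Since |a|^2 = |\<tau>|, the coefficient of x^2 is |\<tau>|^2 / 2,
    which is integrable against the normal density because |\<tau>| < 1.\<close>
  define b where "b = norm a * norm v + norm \<tau> * norm u * norm a"
  define C where "C = exp (norm u * norm v + norm \<tau> * (norm u)\<^sup>2 / 2)"
  have "(\<lambda>n. heat_monomial \<tau> n u * (cnj (heat_monomial \<tau> n v) / fact n)) sums
     (\<integral>x. std_normal_density x *\<^sub>R exp (?s x) \<partial>lborel)"
  proof (rule sums_integral_dominated[where f = ?f])
    show "has_bochner_integral lborel (?f n) (heat_monomial \<tau> n u * (cnj (heat_monomial \<tau> n v) / fact n))" for n
      by (intro has_bochner_integral_mult_left heat_monomial_eq_integral a)
    show "(\<lambda>n. ?f n x) sums (std_normal_density x *\<^sub>R exp (?s x))" for x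
    proof -
      let ?t = "u + a * of_real x"
      have "(\<lambda>n. cnj (heat_monomial \<tau> n v * cnj ?t ^ n / fact n)) sums cnj (exp (cnj ?t * v - \<tau> * (cnj ?t)\<^sup>2 / 2))"
        by (subst sums_cnj) (rule heat_monomial_generating_function)
      then have "(\<lambda>n. cnj (heat_monomial \<tau> n v) * ?t ^ n / fact n) sums exp (?s x)"
        by (simp add: exp_cnj)
      then have "(\<lambda>n. std_normal_density x *\<^sub>R (cnj (heat_monomial \<tau> n v) * ?t ^ n / fact n)) sums (std_normal_density x *\<^sub>R exp (?s x))"
        by (rule sums_scaleR_right)
      then show ?thesis by (simp add: mult_ac scaleR_conv_of_real)
    qed
    show "integrable lborel (\<lambda>x. C * (std_normal_density x * exp (b * \<bar>x\<bar> + (norm \<tau>)\<^sup>2 * x\<^sup>2 / 2)))"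
      by (intro integrable_mult_right integrable_std_normal_exp_abs g)
    show "(\<Sum>n<N. norm (?f n x)) \<le> C * (std_normal_density x * exp (b * \<bar>x\<bar> + (norm \<tau>)\<^sup>2 * x\<^sup>2 / 2))" for N x
    proof -
      let ?y = "norm (u + a * of_real x)" and ?z = "norm u + norm a * \<bar>x\<bar>"
      have y: "?y \<le> ?z" by (rule order.trans[OF norm_triangle_ineq]) (simp add: norm_mult)
      have "(\<Sum>n<N. norm (?f n x)) = std_normal_density x * (\<Sum>n<N. norm (heat_monomial \<tau> n v) * ?y ^ n / fact n)"
        by (simp add: sum_distrib_left norm_mult norm_divide norm_power field_simps)
      also have "\<dots> \<le> std_normal_density x * exp (?y * norm v + norm \<tau> * ?y\<^sup>2 / 2)"
        by (intro mult_left_mono sum_norm_heat_monomial_le) auto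
      also have "\<dots> \<le> std_normal_density x * exp (?z * norm v + norm \<tau> * ?z\<^sup>2 / 2)"
        using y by (auto intro!: mult_left_mono add_mono mult_right_mono power_mono)
      also have "?z * norm v + norm \<tau> * ?z\<^sup>2 / 2 = (norm u * norm v + norm \<tau> * (norm u)\<^sup>2 / 2) + (b * \<bar>x\<bar> + (norm \<tau>)\<^sup>2 * x\<^sup>2 / 2)"
      proof -
        have *: "(norm \<tau>)\<^sup>2 * x\<^sup>2 = norm \<tau> * (norm a)\<^sup>2 * \<bar>x\<bar>\<^sup>2"
          by (simp add: na power2_eq_square[of "norm \<tau>"])
        show ?thesis unfolding b_def * by (simp add: power2_eq_square algebra_simps)
      qed
      finally show ?thesis by (simp add: C_def exp_add mult_ac)
    qed
  qed
  also have "(\<integral>x. std_normal_density x *\<^sub>R exp (?s x) \<partial>lborel)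
      = (\<integral>x. exp (u * cnj v - cnj \<tau> * u\<^sup>2 / 2) * (std_normal_density x *\<^sub>R exp ((a * (cnj v - cnj \<tau> * u)) * of_real x + of_real ((norm \<tau>)\<^sup>2 * x\<^sup>2 / 2))) \<partial>lborel)"
  proof (rule Bochner_Integration.integral_cong[OF refl])
    fix x :: real
    \<comment> \<open>The choice a^2 = - \<tau> makes the quadratic coefficient in x real, so the
      Gaussian integral with real \<open>g\<close> applies.\<close>
    have "cnj \<tau> * (a * of_real x)\<^sup>2 = - of_real ((norm \<tau>)\<^sup>2 * x\<^sup>2)"
      using complex_norm_square[of \<tau>] by (simp add: power_mult_distrib a mult.commute)
    then have "?s x = (u * cnj v - cnj \<tau> * u\<^sup>2 / 2) + ((a * (cnj v - cnj \<tau> * u)) * of_real x + of_real ((norm \<tau>)\<^sup>2 * x\<^sup>2 / 2))"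
      by (simp add: power2_sum field_simps)
    then show "std_normal_density x *\<^sub>R exp (?s x) = exp (u * cnj v - cnj \<tau> * u\<^sup>2 / 2) * (std_normal_density x *\<^sub>R exp ((a * (cnj v - cnj \<tau> * u)) * of_real x + of_real ((norm \<tau>)\<^sup>2 * x\<^sup>2 / 2)))"
      by (simp only: exp_add mult_scaleR_right)
  qed
  also have "\<dots> = exp (u * cnj v - cnj \<tau> * u\<^sup>2 / 2) * (of_real (1 / sqrt (1 - (norm \<tau>)\<^sup>2)) * exp ((a * (cnj v - cnj \<tau> * u))\<^sup>2 / (2 * of_real (1 - (norm \<tau>)\<^sup>2))))"
    by (intro has_bochner_integral_integral_eq has_bochner_integral_mult_right std_normal_exp_quadratic g)
  also have "\<dots> = of_real (1 / sqrt (1 - (norm \<tau>)\<^sup>2)) *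
      exp (u * cnj v - cnj \<tau> * u\<^sup>2 / 2 - \<tau> * (cnj v - cnj \<tau> * u)\<^sup>2 / (2 * of_real (1 - (norm \<tau>)\<^sup>2)))"
  proof -
    have "exp A * (c * exp (- B)) = c * exp (A - B)" for A B c :: complex
      by (simp add: exp_diff exp_minus divide_inverse mult_ac)
    moreover have "(a * (cnj v - cnj \<tau> * u))\<^sup>2 / (2 * of_real (1 - (norm \<tau>)\<^sup>2))
        = - (\<tau> * (cnj v - cnj \<tau> * u)\<^sup>2 / (2 * of_real (1 - (norm \<tau>)\<^sup>2)))"
      unfolding power_mult_distrib a by simp
    ultimately show ?thesis by (simp only:)
  qed
  finally show ?thesis by simp
qed

section \<open>Heat flow of random power series\<close>

lemma summable_power_over_sqrt_fact:
  fixes r :: real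
  assumes "r \<ge> 0"
  shows "summable (\<lambda>n. real (n + 1) * r ^ n / sqrt (fact n))"
\<comment> \<open>For n \<ge> 16 r^2 the new factor r / sqrt (n + 1) is at most 1/4; the growth (n +
  2) / (n + 1) costs at most 2, which leaves the ratio 1/2.\<close>
proof (rule summable_ratio_test[where c = "1/2" and N = "nat \<lceil>16 * r\<^sup>2\<rceil>"])
  fix n assume "n \<ge> nat \<lceil>16 * r\<^sup>2\<rceil>"
  then have "(4 * r)\<^sup>2 \<le> real (n + 1)" by (simp add: power_mult_distrib)
  then have "4 * r \<le> sqrt (real (n + 1))" by (rule real_le_rsqrt)
  then have r: "r / sqrt (real (n + 1)) \<le> 1 / 4" by (simp add: field_simps)
  have sq: "sqrt (fact (Suc n)) = sqrt (real (n + 1)) * sqrt (fact n)"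
    by (simp only: fact_Suc real_sqrt_mult of_nat_fact) simp
  have "real (Suc n + 1) * r ^ Suc n / sqrt (fact (Suc n)) = (real (n + 2) * (r ^ n / sqrt (fact n))) * (r / sqrt (real (n + 1)))"
    unfolding sq by (simp add: mult_ac)
  also have "\<dots> \<le> (real (n + 2) * (r ^ n / sqrt (fact n))) * (1 / 4)"
    using r assms by (intro mult_left_mono) auto
  also have "\<dots> \<le> ((2 * real (n + 1)) * (r ^ n / sqrt (fact n))) * (1 / 4)"
    using assms by (intro mult_right_mono) auto
  also have "\<dots> = 1 / 2 * (real (n + 1) * r ^ n / sqrt (fact n))" by (simp add: field_simps)
  finally have le: "real (Suc n + 1) * r ^ Suc n / sqrt (fact (Suc n)) \<le> 1 / 2 * (real (n + 1) * r ^ n / sqrt (fact n))" .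
  have "norm (real (k + 1) * r ^ k / sqrt (fact k)) = real (k + 1) * r ^ k / sqrt (fact k)" for k
    using assms by simp
  with le show "norm (real (Suc n + 1) * r ^ Suc n / sqrt (fact (Suc n))) \<le> 1 / 2 * norm (real (n + 1) * r ^ n / sqrt (fact n))"
    by (simp only:)
qed simp

section \<open>Power series and rearrangement of double series\<close>

lemma higher_deriv_power_series:
  fixes c :: "nat \<Rightarrow> complex"
  assumes "\<And>z. summable (\<lambda>n. c n * z ^ n)"
  shows "summable (\<lambda>n. (fact (n + j) / fact n * c (n + j)) * z ^ n) \<and>
         (deriv ^^ j) (\<lambda>z. \<Sum>n. c n * z ^ n) z = (\<Sum>n. (fact (n + j) / fact n * c (n + j)) * z ^ n)"
proof (induction j arbitrary: z)
  case 0
  then show ?case using assms by simp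
next
  case (Suc j)
  let ?c = "\<lambda>n. fact (n + j) / fact n * c (n + j)"
  have d: "diffs ?c n = fact (n + Suc j) / fact n * c (n + Suc j)" for n
    by (simp add: diffs_def del: of_nat_Suc)
  have s: "summable (\<lambda>n. ?c n * z ^ n)" for z using Suc.IH by blast
  have "(deriv ^^ Suc j) (\<lambda>z. \<Sum>n. c n * z ^ n) z = deriv (\<lambda>z. \<Sum>n. ?c n * z ^ n) z"
  proof -
    have "(deriv ^^ j) (\<lambda>z. \<Sum>n. c n * z ^ n) = (\<lambda>z. \<Sum>n. ?c n * z ^ n)" using Suc.IH by blast
    then show ?thesis by simp
  qed
  also have "\<dots> = (\<Sum>n. diffs ?c n * z ^ n)"
    by (rule DERIV_imp_deriv[OF termdiffs_strong_converges_everywhere[OF s]])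
  finally have "(deriv ^^ Suc j) (\<lambda>z. \<Sum>n. c n * z ^ n) z = (\<Sum>n. diffs ?c n * z ^ n)" .
  with termdiff_converges_all[OF s, of z] show ?case unfolding d by blast
qed

lemma holomorphic_power_series_UNIV:
  fixes c :: "nat \<Rightarrow> complex"
  assumes "\<And>z. (\<lambda>n. c n * z ^ n) sums f z"
  shows "f holomorphic_on UNIV"
proof -
  have "f = (\<lambda>z. \<Sum>n. c n * z ^ n)" using assms by (auto simp: sums_iff)
  moreover have "summable (\<lambda>n. c n * z ^ n)" for z using assms by (auto simp: sums_iff)
  ultimately show ?thesis
    using termdiffs_strong_converges_everywhere[of c]
    by (auto simp: holomorphic_on_def field_differentiable_def intro: has_field_derivative_at_within)
qed

lemma summable_on_prod_comparison:
  fixes f :: "nat \<times> nat \<Rightarrow> complex" and A B :: "nat \<Rightarrow> real"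
  assumes A: "summable A" "\<And>m. A m \<ge> 0" and B: "summable B" "\<And>k. B k \<ge> 0"
    and f: "\<And>m k. norm (f (m, k)) \<le> A m * B k"
  shows "f summable_on UNIV"
proof -
  have a: "(A has_sum suminf A) UNIV" and b: "(B has_sum suminf B) UNIV"
    using A B by (auto intro!: sums_nonneg_imp_has_sum summable_sums)
  have g: "(\<lambda>m. A m * suminf B) summable_on UNIV"
    by (intro summable_on_cmult_left has_sum_imp_summable[OF a])
  have "(\<lambda>(m,k). A m * B k) summable_on (SIGMA m:UNIV. UNIV)"
  proof (rule summable_on_SigmaI[OF _ g])
    show "((\<lambda>k. case (m, k) of (m, k) \<Rightarrow> A m * B k) has_sum A m * suminf B) UNIV" for m
      using has_sum_cmult_right[OF b, of "A m"] by simp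
    show "0 \<le> (case (m, k) of (m, k) \<Rightarrow> A m * B k)" for m k
      using A(2)[of m] B(2)[of k] by simp
  qed
  then have "(\<lambda>p. norm (case p of (m, k) \<Rightarrow> A m * B k)) summable_on UNIV"
    using iffD1[OF summable_on_iff_abs_summable_on_real] by simp
  then have "(\<lambda>p. norm (f p)) summable_on UNIV"
  proof (rule Infinite_Sum.abs_summable_on_comparison_test)
    show "norm (f p) \<le> norm (case p of (m, k) \<Rightarrow> A m * B k)" for p
      using f[of "fst p" "snd p"] A(2)[of "fst p"] B(2)[of "snd p"] by (simp add: case_prod_beta)
  qed
  then show ?thesis by (rule Infinite_Sum.abs_summable_summable)
qed

text \<open>In the application \<open>k\<close> counts the terms of the heat series,
  \<open>m\<close> is the exponent of the variable and n = m + 2k is the index of the random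
  coefficient. Summation over m for fixed k gives the heat terms, over k for fixed m a power series
  (hence holomorphy), and along fixed n the series in \<open>heat_monomial\<close>.\<close>

lemma double_series_regroup:
  fixes f :: "nat \<times> nat \<Rightarrow> complex"
  assumes f: "f summable_on UNIV"
  shows "(\<lambda>k. \<Sum>m. f (m, k)) sums infsum f UNIV"
    and "(\<lambda>m. \<Sum>k. f (m, k)) sums infsum f UNIV"
    and "(\<lambda>n. \<Sum>k\<le>n div 2. f (n - 2 * k, k)) sums infsum f UNIV"
proof -
  have S: "(f has_sum infsum f UNIV) (UNIV \<times> UNIV)" using f by simp
  have row: "(\<lambda>k. f (m, k)) summable_on UNIV" for m
    using summable_on_SigmaD1[of "curry f" UNIV "\<lambda>_. UNIV" m] f by (simp add: curry_def)
  have row': "((\<lambda>k. f (m, k)) has_sum (\<Sum>k. f (m, k))) UNIV" for m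
    using row[of m] has_sum_imp_sums[OF has_sum_infsum[OF row]] by (auto simp: sums_iff)
  have "((\<lambda>m. \<Sum>k. f (m, k)) has_sum infsum f UNIV) UNIV"
    by (rule has_sum_SigmaD[OF S row'])
  then show "(\<lambda>m. \<Sum>k. f (m, k)) sums infsum f UNIV" by (rule has_sum_imp_sums)
  have S': "((\<lambda>(k, m). f (m, k)) has_sum infsum f UNIV) (UNIV \<times> UNIV)"
    using S by (subst (asm) has_sum_swap)
  have col: "(\<lambda>m. f (m, k)) summable_on UNIV" for k
    using summable_on_SigmaD1[of "\<lambda>k m. f (m, k)" UNIV "\<lambda>_. UNIV" k] S' by (auto simp: summable_on_def)
  have col': "((\<lambda>m. (case (k, m) of (k, m) \<Rightarrow> f (m, k))) has_sum (\<Sum>m. f (m, k))) UNIV" for k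
    using has_sum_imp_sums[OF has_sum_infsum[OF col[of k]]] has_sum_infsum[OF col[of k]] by (auto simp: sums_iff)
  have "((\<lambda>k. \<Sum>m. f (m, k)) has_sum infsum f UNIV) UNIV"
    by (rule has_sum_SigmaD[OF S' col'])
  then show "(\<lambda>k. \<Sum>m. f (m, k)) sums infsum f UNIV" by (rule has_sum_imp_sums)
  \<comment> \<open>The truncated subtraction n - 2k is exact here because k ranges only up to n div
    2.\<close>
  have "((\<lambda>(n, k). f (n - 2 * k, k)) has_sum infsum f UNIV) (SIGMA n:UNIV. {..n div 2}) \<longleftrightarrow> (f has_sum infsum f UNIV) UNIV"
    by (rule has_sum_reindex_bij_witness[where i = "\<lambda>(m, k). (m + 2 * k, k)" and j = "\<lambda>(n, k). (n - 2 * k, k)"]) auto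
  then have "((\<lambda>(n, k). f (n - 2 * k, k)) has_sum infsum f UNIV) (SIGMA n:UNIV. {..n div 2})"
    using S by simp
  then have "((\<lambda>n. \<Sum>k\<le>n div 2. f (n - 2 * k, k)) has_sum infsum f UNIV) UNIV"
    by (rule has_sum_SigmaD) (auto intro: has_sum_finiteI)
  then show "(\<lambda>n. \<Sum>k\<le>n div 2. f (n - 2 * k, k)) sums infsum f UNIV" by (rule has_sum_imp_sums)
qed

text \<open>Separates analysis from probability: this property is shown to hold almost surely, and
  all convergence is then proved for one fixed coefficient sequence.\<close>

definition linear_growth :: "(nat \<Rightarrow> complex) \<Rightarrow> bool" where
  "linear_growth x \<longleftrightarrow> (\<exists>C. \<forall>n. norm (x n) \<le> C * real (n + 1))"

lemma linear_growth_nonneg: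
  assumes "linear_growth x"
  obtains C where "C \<ge> 0" "\<And>n. norm (x n) \<le> C * real (n + 1)"
proof -
  obtain C where C: "\<And>n. norm (x n) \<le> C * real (n + 1)" using assms by (auto simp: linear_growth_def)
  have "C \<ge> 0" using order.trans[OF norm_ge_zero C[of 0]] by simp
  then show ?thesis using C that by blast
qed

section \<open>Pathwise convergence of the random series and of its heat flow\<close>

lemma gaf_summable:
  assumes "linear_growth (\<lambda>n. \<xi> n \<omega>)"
  shows "summable (\<lambda>n. \<xi> n \<omega> * (z ^ n / of_real (sqrt (fact n))))"
proof -
  obtain C where C: "C \<ge> 0" "\<And>n. norm (\<xi> n \<omega>) \<le> C * real (n + 1)"
    using linear_growth_nonneg[OF assms] by blast
  show ?thesis
  proof (rule summable_comparison_test)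
    show "summable (\<lambda>n. C * (real (n + 1) * norm z ^ n / sqrt (fact n)))"
      by (intro summable_mult summable_power_over_sqrt_fact) simp
    show "\<exists>N. \<forall>n\<ge>N. norm (\<xi> n \<omega> * (z ^ n / of_real (sqrt (fact n)))) \<le> C * (real (n + 1) * norm z ^ n / sqrt (fact n))"
      using mult_right_mono[OF C(2), of "norm z ^ _ / sqrt (fact _)"]
      by (intro exI[of _ 0]) (auto simp: norm_mult norm_divide norm_power mult_ac)
  qed
qed

lemma gaf_sums:
  assumes "linear_growth (\<lambda>n. \<xi> n \<omega>)"
  shows "(\<lambda>n. \<xi> n \<omega> * (z ^ n / of_real (sqrt (fact n)))) sums gaf \<xi> \<omega> z"
  using gaf_summable[of \<xi> \<omega>, OF assms] by (simp add: gaf_def summable_sums)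

lemma gaf_holomorphic:
  assumes "linear_growth (\<lambda>n. \<xi> n \<omega>)"
  shows "gaf \<xi> \<omega> holomorphic_on UNIV"
  by (rule holomorphic_power_series_UNIV[where c = "\<lambda>n. \<xi> n \<omega> / of_real (sqrt (fact n))"])
    (use gaf_sums[of \<xi> \<omega>, OF assms] in simp)

text \<open>The weight \<open>\<rho>\<close> comes from one term of the binomial expansion of
  \<open>((1 - \<rho>) + \<rho>) ^ (m + 2 * k + 1) = 1\<close>; it decouples the two summation indices.\<close>

lemma heat_coefficient_bound:
  fixes t \<rho> :: real
  assumes "0 \<le> t" "0 < \<rho>" "\<rho> < 1"
  shows "real (m + 2 * k + 1) * ((1 / fact k) * (t / 2) ^ k * (sqrt (fact (m + 2 * k)) / fact m))
     \<le> (real (m + 1) * (1 / (1 - \<rho>)) ^ (m + 1) / sqrt (fact m)) * (t / \<rho>\<^sup>2) ^ k"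
proof -
  let ?n = "m + 2 * k"
  \<comment> \<open>The bound 4^k for the central binomial coefficient gives (2k)! \<le> (2^k k!)^2,
    so sqrt ((2k)!) cancels against the factor 1 / (2^k k!) of the heat series.\<close>
  have "real ((2 * k) choose k) \<le> 2 ^ (2 * k)"
    using binomial_le_pow2[of "2 * k" k] by (simp flip: of_nat_le_iff)
  then have c: "(fact (2 * k) :: real) \<le> (2 ^ k * fact k)\<^sup>2"
    by (simp add: binomial_fact field_simps power2_eq_square power_mult power_mult_distrib flip: power_mult_distrib)
  \<comment> \<open>A binomial coefficient is at least 1, so it may be squared before the root is
    taken; the weight \<rho> absorbs this loss.\<close>
  have b1: "real (?n choose m) \<ge> 1" by (simp add: Suc_le_eq)
  have "fact ?n = real (?n choose m) * (fact m * fact (2 * k))"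
    by (simp add: binomial_fact)
  also have "\<dots> \<le> (real (?n choose m))\<^sup>2 * (fact m * (2 ^ k * fact k)\<^sup>2)"
    using c b1 by (intro mult_mono) (auto simp: power2_eq_square)
  finally have "sqrt (fact ?n) \<le> sqrt ((real (?n choose m))\<^sup>2 * (fact m * (2 ^ k * fact k)\<^sup>2))"
    by (simp only: real_sqrt_le_iff)
  also have "\<dots> = real (?n choose m) * (sqrt (fact m) * (2 ^ k * fact k))"
    by (simp add: real_sqrt_mult)
  finally have s: "sqrt (fact ?n) \<le> real (?n choose m) * (sqrt (fact m) * (2 ^ k * fact k))" .
  \<comment> \<open>The factor n + 1 contributed by the linear growth is absorbed into the next
    binomial coefficient, at the price of a harmless m + 1.\<close>
  have e1: "real (?n + 1) * real (?n choose m) = real (m + 1) * real (Suc ?n choose Suc m)"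
    using Suc_times_binomial[of m ?n] by (metis Suc_eq_plus1 of_nat_mult)
  have "real (Suc ?n choose Suc m) * ((1 - \<rho>) ^ (m + 1) * (\<rho>\<^sup>2) ^ k) \<le> 1"
  proof -
    have "real (Suc ?n choose Suc m) * (1 - \<rho>) ^ Suc m * \<rho> ^ (Suc ?n - Suc m)
        \<le> (\<Sum>j\<le>Suc ?n. real (Suc ?n choose j) * (1 - \<rho>) ^ j * \<rho> ^ (Suc ?n - j))"
      using assms by (intro member_le_sum) auto
    also have "\<dots> = ((1 - \<rho>) + \<rho>) ^ Suc ?n" by (rule binomial_ring[symmetric])
    finally show ?thesis by (simp add: mult.assoc flip: power_mult)
  qed
  then have e2: "real (Suc ?n choose Suc m) \<le> (1 / (1 - \<rho>)) ^ (m + 1) * (1 / \<rho>\<^sup>2) ^ k"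
    using assms by (simp only: power_one_over times_divide_times_eq mult_1 pos_le_divide_eq zero_less_power mult_pos_pos diff_gt_0_iff_gt)
  have b: "real (?n + 1) * real (?n choose m) \<le> real (m + 1) * ((1 / (1 - \<rho>)) ^ (m + 1) * (1 / \<rho>\<^sup>2) ^ k)"
    unfolding e1 by (intro mult_left_mono e2) simp
  have "real (?n + 1) * ((1 / fact k) * (t / 2) ^ k * (sqrt (fact ?n) / fact m))
      \<le> real (?n + 1) * ((1 / fact k) * (t / 2) ^ k * (real (?n choose m) * (sqrt (fact m) * (2 ^ k * fact k)) / fact m))"
    using assms by (intro mult_left_mono[OF mult_left_mono[OF divide_right_mono[OF s]]]) simp_all
  also have "\<dots> = (real (?n + 1) * real (?n choose m)) * (t ^ k * (sqrt (fact m) / fact m))"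
  proof -
    have "N * ((1 / F) * (T / p) * (b * (r * (p * F)) / f)) = (N * b) * (T * (r / f))"
      if "F \<noteq> 0" "p \<noteq> 0" for N F T p b r f :: real
      using that by simp
    then show ?thesis unfolding power_divide by (simp del: of_nat_Suc of_nat_add)
  qed
  also have "\<dots> \<le> (real (m + 1) * ((1 / (1 - \<rho>)) ^ (m + 1) * (1 / \<rho>\<^sup>2) ^ k)) * (t ^ k * (sqrt (fact m) / fact m))"
    using assms by (intro mult_right_mono[OF b]) simp
  also have "sqrt (fact m) / fact m = 1 / sqrt (fact m)"
    by (simp add: sqrt_divide_self_eq inverse_eq_divide)
  finally show ?thesis
    by (simp add: power_divide mult_ac del: of_nat_Suc of_nat_add)
qed

text \<open>With n = m + 2k, the 2k-th derivative of x_n z^n / sqrt (n!) has the coefficient x_n (n!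
  / m!) / sqrt (n!) = x_n sqrt (n!) / m!. A product bound A m * B k decouples the indices: A decays
  superexponentially, B geometrically.\<close>

lemma heat_double_series:
  assumes x: "linear_growth x" and \<tau>: "norm \<tau> < 1"
  shows "(\<lambda>(m, k). (1 / fact k * (- \<tau> / 2) ^ k) * (x (m + 2 * k) * of_real (sqrt (fact (m + 2 * k)) / fact m)) * w ^ m)
           summable_on UNIV"
proof -
  obtain C where C: "C \<ge> 0" "\<And>n. norm (x n) \<le> C * real (n + 1)"
    using linear_growth_nonneg[OF x] by blast
  \<comment> \<open>The midpoint of sqrt |\<tau>| and 1 satisfies |\<tau>| < \<rho>^2 < 1, so the
    geometric ratio |\<tau>| / \<rho>^2 of \<open>B\<close> is below 1.\<close>
  define \<rho> where "\<rho> = (1 + sqrt (norm \<tau>)) / 2"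
  have \<rho>: "0 < \<rho>" "\<rho> < 1" using \<tau> by (auto simp: \<rho>_def add_pos_nonneg)
  have "sqrt (norm \<tau>) < \<rho>" using \<tau> by (simp add: \<rho>_def)
  then have "(sqrt (norm \<tau>))\<^sup>2 < \<rho>\<^sup>2" by (intro power_strict_mono) auto
  then have q: "norm \<tau> / \<rho>\<^sup>2 < 1" using \<rho> by (simp add: field_simps)
  define A where "A m = C / (1 - \<rho>) * (real (m + 1) * (norm w / (1 - \<rho>)) ^ m / sqrt (fact m))" for m
  define B where "B k = (norm \<tau> / \<rho>\<^sup>2) ^ k" for k
  show ?thesis
  proof (rule summable_on_prod_comparison[of A B])
    show "summable A" unfolding A_def using \<rho> by (intro summable_mult summable_power_over_sqrt_fact) auto
    show "summable B" unfolding B_def using q \<rho> by (intro summable_geometric) auto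
    show "A m \<ge> 0" "B k \<ge> 0" for m k using C \<rho> by (auto simp: A_def B_def)
    show "norm (case (m, k) of (m, k) \<Rightarrow> (1 / fact k * (- \<tau> / 2) ^ k) * (x (m + 2 * k) * of_real (sqrt (fact (m + 2 * k)) / fact m)) * w ^ m) \<le> A m * B k" for m k
    proof -
      have "norm (case (m, k) of (m, k) \<Rightarrow> (1 / fact k * (- \<tau> / 2) ^ k) * (x (m + 2 * k) * of_real (sqrt (fact (m + 2 * k)) / fact m)) * w ^ m)
        = norm (x (m + 2 * k)) * ((1 / fact k) * (norm \<tau> / 2) ^ k * (sqrt (fact (m + 2 * k)) / fact m)) * norm w ^ m"
        by (simp add: norm_mult norm_divide norm_power)
      also have "\<dots> \<le> (C * real (m + 2 * k + 1)) * ((1 / fact k) * (norm \<tau> / 2) ^ k * (sqrt (fact (m + 2 * k)) / fact m)) * norm w ^ m"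
        by (intro mult_right_mono C) auto
      also have "\<dots> = (C * norm w ^ m) * (real (m + 2 * k + 1) * ((1 / fact k) * (norm \<tau> / 2) ^ k * (sqrt (fact (m + 2 * k)) / fact m)))"
        by (simp only: mult_ac)
      also have "\<dots> \<le> (C * norm w ^ m) * ((real (m + 1) * (1 / (1 - \<rho>)) ^ (m + 1) / sqrt (fact m)) * (norm \<tau> / \<rho>\<^sup>2) ^ k)"
        using C \<rho> by (intro mult_left_mono heat_coefficient_bound) auto
      also have "\<dots> = A m * B k"
        by (simp add: A_def B_def power_divide mult_ac)
      finally show ?thesis .
    qed
  qed
qed

lemma heat_flow_gaf:
  assumes x: "linear_growth (\<lambda>n. \<xi> n \<omega>)" and \<tau>: "norm \<tau> < 1"
  shows "summable (heat_term \<tau> (gaf \<xi> \<omega>) w)"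
    and "(\<lambda>n. \<xi> n \<omega> * (heat_monomial \<tau> n w / of_real (sqrt (fact n)))) sums heat_flow \<tau> (gaf \<xi> \<omega>) w"
    and "heat_flow \<tau> (gaf \<xi> \<omega>) holomorphic_on UNIV"
proof -
  define f where "f w = (\<lambda>(m, k). (1 / fact k * (- \<tau> / 2) ^ k) * (\<xi> (m + 2 * k) \<omega> * of_real (sqrt (fact (m + 2 * k)) / fact m)) * w ^ m)" for w
  have f: "f w summable_on UNIV" for w
    unfolding f_def by (rule heat_double_series[OF x \<tau>])
  define c where "c n = \<xi> n \<omega> / of_real (sqrt (fact n))" for n
  have gaf: "gaf \<xi> \<omega> = (\<lambda>z. \<Sum>n. c n * z ^ n)"
    by (simp add: gaf_def c_def fun_eq_iff)
  have sc: "summable (\<lambda>n. c n * z ^ n)" for z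
    using gaf_summable[of \<xi> \<omega>, OF x] by (simp add: c_def)
  have s: "fact n * (y / of_real (sqrt (fact n))) = of_real (sqrt (fact n)) * y" for n and y :: complex
  proof -
    have "(of_real (sqrt (fact n)) :: complex) * of_real (sqrt (fact n)) = of_real (fact n)"
      unfolding of_real_mult[symmetric] by simp
    then show ?thesis by (simp add: field_simps)
  qed
  have t: "heat_term \<tau> (gaf \<xi> \<omega>) w k = (\<Sum>m. f w (m, k))" for w k
  proof -
    note hd = higher_deriv_power_series[OF sc, of "2 * k" w]
    have "heat_term \<tau> (gaf \<xi> \<omega>) w k
        = (\<Sum>m. (1 / fact k * (- \<tau> / 2) ^ k) * ((fact (m + 2 * k) / fact m * c (m + 2 * k)) * w ^ m))"
      unfolding heat_term_def gaf using hd by (subst suminf_mult) auto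
    also have "\<dots> = (\<Sum>m. f w (m, k))"
    proof (rule suminf_cong)
      fix m
      show "(1 / fact k * (- \<tau> / 2) ^ k) * ((fact (m + 2 * k) / fact m * c (m + 2 * k)) * w ^ m) = f w (m, k)"
    proof -
      have "fact (m + 2 * k) / fact m * c (m + 2 * k) = fact (m + 2 * k) * c (m + 2 * k) / fact m" by simp
      also have "\<dots> = \<xi> (m + 2 * k) \<omega> * of_real (sqrt (fact (m + 2 * k)) / fact m)"
        unfolding c_def s by simp
      finally show ?thesis by (simp add: f_def)
    qed
    qed
    finally show ?thesis .
  qed
  have 1: "heat_term \<tau> (gaf \<xi> \<omega>) w sums infsum (f w) UNIV" for w
    unfolding t by (rule double_series_regroup(1)[OF f])
  have F: "heat_flow \<tau> (gaf \<xi> \<omega>) w = infsum (f w) UNIV" for w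
    using 1[of w] by (simp add: heat_flow_def sums_iff)
  show "summable (heat_term \<tau> (gaf \<xi> \<omega>) w)" using 1[of w] by (simp add: sums_iff)
  have "(\<Sum>k\<le>n div 2. f w (n - 2 * k, k)) = \<xi> n \<omega> * (heat_monomial \<tau> n w / of_real (sqrt (fact n)))" for n
    unfolding heat_monomial_def sum_divide_distrib sum_distrib_left
  proof (rule sum.cong[OF refl])
    fix k assume "k \<in> {..n div 2}"
    then have "n - 2 * k + 2 * k = n" by auto
    moreover have "\<xi> n \<omega> * (p * (fact n / q) * y / of_real (sqrt (fact n))) = p * (fact n * (\<xi> n \<omega> / of_real (sqrt (fact n)))) / q * y" for p q y
      by (simp add: mult_ac)
    ultimately show "f w (n - 2 * k, k) = \<xi> n \<omega> * (1 / fact k * (- \<tau> / 2) ^ k * (fact n / fact (n - 2 * k)) * w ^ (n - 2 * k) / of_real (sqrt (fact n)))"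
      unfolding s by (simp add: f_def)
  qed
  with double_series_regroup(3)[OF f[of w]]
  show "(\<lambda>n. \<xi> n \<omega> * (heat_monomial \<tau> n w / of_real (sqrt (fact n)))) sums heat_flow \<tau> (gaf \<xi> \<omega>) w"
    by (simp add: F)
  \<comment> \<open>Since w^m factors out of \<open>f w (m, k)\<close>, the power series
    coefficients can be read off at w = 1.\<close>
  define d where "d m = (\<Sum>k. f 1 (m, k))" for m
  have "(\<lambda>m. d m * w ^ m) sums heat_flow \<tau> (gaf \<xi> \<omega>) w" for w
  proof -
    have "(\<Sum>k. f w (m, k)) = d m * w ^ m" for m
    proof -
      have "summable (\<lambda>k. f 1 (m, k))"
        using summable_on_SigmaD1[of "curry (f 1)" UNIV "\<lambda>_. UNIV" m] f[of 1]
        by (intro summable_on_imp_summable) (simp add: curry_def)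
      then have "d m * w ^ m = (\<Sum>k. f 1 (m, k) * w ^ m)" unfolding d_def by (rule suminf_mult2)
      then show ?thesis by (simp add: f_def)
    qed
    then show ?thesis using double_series_regroup(2)[OF f[of w]] by (simp add: F)
  qed
  then show "heat_flow \<tau> (gaf \<xi> \<omega>) holomorphic_on UNIV"
    by (rule holomorphic_power_series_UNIV)
qed

section \<open>Standard complex Gaussian sequences\<close>

lemma lborel_complex_eq_distr:
  "(lborel :: complex measure) = distr (lborel \<Otimes>\<^sub>M lborel) borel (\<lambda>(x, y). Complex x y)"
proof (rule lborel_eqI)
  have m: "(\<lambda>(x, y). Complex x y) \<in> lborel \<Otimes>\<^sub>M lborel \<rightarrow>\<^sub>M borel"
    unfolding Complex_eq by measurable
  fix l u :: complex
  assume le: "\<And>b. b \<in> Basis \<Longrightarrow> l \<bullet> b \<le> u \<bullet> b"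
  have "(\<lambda>(x, y). Complex x y) -` box l u \<inter> space (lborel \<Otimes>\<^sub>M lborel) = {Re l<..<Re u} \<times> {Im l<..<Im u}"
    by (auto simp: in_box_complex_iff space_pair_measure)
  then show "emeasure (distr (lborel \<Otimes>\<^sub>M lborel) borel (\<lambda>(x, y). Complex x y)) (box l u) = ennreal (\<Prod>b\<in>Basis. (u - l) \<bullet> b)"
    using m le[of 1] le[of \<i>]
    by (simp add: emeasure_distr lborel.emeasure_pair_measure_Times Basis_complex_def inner_diff_left ennreal_mult)
qed simp

lemma has_bochner_integral_lborel_complex:
  fixes f g :: "real \<Rightarrow> complex"
  assumes f: "has_bochner_integral lborel f a" and g: "has_bochner_integral lborel g b"
  shows "has_bochner_integral lborel (\<lambda>z. f (Re z) * g (Im z)) (a * b)"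
proof -
  have [measurable]: "f \<in> borel_measurable borel" "g \<in> borel_measurable borel"
    using f g by (auto simp: has_bochner_integral_iff dest: borel_measurable_integrable)
  have fi: "integrable lborel f" and gi: "integrable lborel g"
    using f g by (auto simp: has_bochner_integral_iff)
  have i: "integrable (lborel \<Otimes>\<^sub>M lborel) (\<lambda>(x, y). f x * g y)"
    by (rule lborel_pair.Fubini_integrable) (auto intro!: integrable_mult_right gi fi simp: norm_mult)
  moreover have "(\<integral>p. (case p of (x, y) \<Rightarrow> f x * g y) \<partial>(lborel \<Otimes>\<^sub>M lborel)) = a * b"
    using lborel_pair.integral_fst'[OF i] f g by (simp add: has_bochner_integral_iff)
  ultimately have h: "has_bochner_integral (lborel \<Otimes>\<^sub>M lborel) (\<lambda>(x, y). f x * g y) (a * b)"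
    by (simp add: has_bochner_integral_iff)
  have m: "(\<lambda>(x, y). Complex x y) \<in> lborel \<Otimes>\<^sub>M lborel \<rightarrow>\<^sub>M borel"
    unfolding Complex_eq by measurable
  show ?thesis
    unfolding lborel_complex_eq_distr
    by (rule has_bochner_integral_distr[OF _ m]) (use h in \<open>simp_all add: case_prod_unfold\<close>)
qed

lemma gaussian_density_exp:
  fixes \<beta> :: complex
  shows "has_bochner_integral lborel (\<lambda>x. of_real (exp (- x\<^sup>2) / sqrt pi) * exp (\<beta> * of_real x)) (exp (\<beta>\<^sup>2 / 4))"
proof -
  \<comment> \<open>With g = -1 the integrand contains exp (- x^2) / sqrt (2 pi); the factor sqrt 2
    corrects the normalization.\<close>
  have "has_bochner_integral lborel (\<lambda>x. of_real (sqrt 2) * (std_normal_density x *\<^sub>R exp (\<beta> * of_real x + of_real ((-1) * x\<^sup>2 / 2))))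
      (of_real (sqrt 2) * (of_real (1 / sqrt (1 - (-1))) * exp (\<beta>\<^sup>2 / (2 * of_real (1 - (-1))))))"
    by (intro has_bochner_integral_mult_right std_normal_exp_quadratic) simp
  moreover have "of_real (sqrt 2) * (std_normal_density x *\<^sub>R exp (\<beta> * of_real x + of_real ((-1) * x\<^sup>2 / 2)))
      = of_real (exp (- x\<^sup>2) / sqrt pi) * exp (\<beta> * of_real x)" for x
  proof -
    have "exp (- x\<^sup>2) = exp (- x\<^sup>2 / 2) * exp (- x\<^sup>2 / 2)" by (simp add: mult_exp_exp)
    then have "exp (- x\<^sup>2) / sqrt pi = sqrt 2 * (std_normal_density x * exp ((-1) * x\<^sup>2 / 2))"
      by (simp add: std_normal_density_def real_sqrt_mult)
    moreover have "exp (\<beta> * of_real x + of_real ((-1) * x\<^sup>2 / 2)) = exp (\<beta> * of_real x) * of_real (exp ((-1) * x\<^sup>2 / 2))"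
      by (simp only: exp_add exp_of_real)
    ultimately show ?thesis by (simp only: scaleR_conv_of_real of_real_mult mult_ac)
  qed
  ultimately show ?thesis by (simp add: real_sqrt_divide)
qed

text \<open>Re (b z) = Re b Re z - Im b Im z splits the integral into two real ones. The result
  depends on b only through |b|; this rotation invariance is why only the sums of |\<beta>_n|^2
  matter later.\<close>

lemma complex_gaussian_density_exp_Re:
  "has_bochner_integral lborel (\<lambda>z. of_real (exp (- (cmod z)\<^sup>2) / pi) * iexp (Re (b * z)))
     (of_real (exp (- (cmod b)\<^sup>2 / 4)))"
proof -
  have "has_bochner_integral lborel (\<lambda>z. (of_real (exp (- (Re z)\<^sup>2) / sqrt pi) * exp ((\<i> * of_real (Re b)) * of_real (Re z))) *
       (of_real (exp (- (Im z)\<^sup>2) / sqrt pi) * exp ((- \<i> * of_real (Im b)) * of_real (Im z))))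
     (exp ((\<i> * of_real (Re b))\<^sup>2 / 4) * exp ((- \<i> * of_real (Im b))\<^sup>2 / 4))"
    by (intro has_bochner_integral_lborel_complex gaussian_density_exp)
  moreover have "(of_real (exp (- (Re z)\<^sup>2) / sqrt pi) * exp ((\<i> * of_real (Re b)) * of_real (Re z))) *
       (of_real (exp (- (Im z)\<^sup>2) / sqrt pi) * exp ((- \<i> * of_real (Im b)) * of_real (Im z)))
     = of_real (exp (- (cmod z)\<^sup>2) / pi) * iexp (Re (b * z))" for z
  proof -
    have e: "exp (- (Re z)\<^sup>2) / sqrt pi * (exp (- (Im z)\<^sup>2) / sqrt pi) = exp (- (cmod z)\<^sup>2) / pi"
      by (simp add: cmod_power2 mult_exp_exp)
    have "(of_real (exp (- (Re z)\<^sup>2) / sqrt pi) * exp ((\<i> * of_real (Re b)) * of_real (Re z))) *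
       (of_real (exp (- (Im z)\<^sup>2) / sqrt pi) * exp ((- \<i> * of_real (Im b)) * of_real (Im z)))
     = of_real (exp (- (Re z)\<^sup>2) / sqrt pi * (exp (- (Im z)\<^sup>2) / sqrt pi)) * (exp ((\<i> * of_real (Re b)) * of_real (Re z)) * exp ((- \<i> * of_real (Im b)) * of_real (Im z)))"
      by (simp only: of_real_mult mult_ac)
    also have "exp ((\<i> * of_real (Re b)) * of_real (Re z)) * exp ((- \<i> * of_real (Im b)) * of_real (Im z)) = iexp (Re (b * z))"
      by (simp add: mult_exp_exp algebra_simps)
    finally show ?thesis unfolding e .
  qed
  moreover have "exp ((\<i> * of_real (Re b))\<^sup>2 / 4) * exp ((- \<i> * of_real (Im b))\<^sup>2 / 4) = (of_real (exp (- (cmod b)\<^sup>2 / 4)) :: complex)"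
    unfolding cmod_power2 exp_of_real[symmetric] by (simp add: mult_exp_exp power_mult_distrib add_divide_distrib diff_divide_distrib)
  ultimately show ?thesis by simp
qed

lemma complex_gaussian_second_moment_finite:
  "(\<integral>\<^sup>+z. ennreal (exp (- (cmod z)\<^sup>2) / pi) * ennreal ((cmod z)\<^sup>2) \<partial>lborel) < \<infinity>"
proof -
  have "has_bochner_integral lborel (\<lambda>z. (std_normal_density (Re z) *\<^sub>R exp (0 * of_real (Re z))) * (std_normal_density (Im z) *\<^sub>R exp (0 * of_real (Im z)))) (exp (0\<^sup>2 / 2) * exp (0\<^sup>2 / 2) :: complex)"
    by (intro has_bochner_integral_lborel_complex std_normal_exp)
  then have "integrable lborel (\<lambda>z. norm (std_normal_density (Re z) *\<^sub>R exp (0 * of_real (Re z)) * (std_normal_density (Im z) *\<^sub>R exp (0 * of_real (Im z))) :: complex))"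
    by (intro integrable_norm integrable.intros)
  then have i: "integrable lborel (\<lambda>z. std_normal_density (Re z) * std_normal_density (Im z))"
    by (simp add: norm_mult mult.commute)
  have "exp (- (cmod z)\<^sup>2) / pi * (cmod z)\<^sup>2 \<le> 4 * (std_normal_density (Re z) * std_normal_density (Im z))" for z
  proof -
    let ?r = "(cmod z)\<^sup>2"
    have "std_normal_density (Re z) * std_normal_density (Im z) = exp (- ?r / 2) / (2 * pi)"
      by (simp add: std_normal_density_def cmod_power2 mult_exp_exp add_divide_distrib field_simps)
    \<comment> \<open>Half of the Gaussian decay is spent on the factor r; the remaining exp (- r /
      2) is a multiple of the product of two standard normal densities, and the constants combine to
      4.\<close>
    moreover have "?r \<le> 2 * exp (?r / 2)" using exp_ge_add_one_self[of "?r / 2"] by linarith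
    then have "exp (- ?r) * ?r \<le> exp (- ?r) * (2 * exp (?r / 2))" by (intro mult_left_mono) auto
    then have "exp (- ?r) * ?r \<le> 2 * exp (- ?r / 2)" by (simp add: mult_exp_exp field_simps)
    ultimately show ?thesis by (simp add: field_simps)
  qed
  then have "(\<integral>\<^sup>+z. ennreal (exp (- (cmod z)\<^sup>2) / pi) * ennreal ((cmod z)\<^sup>2) \<partial>lborel)
      \<le> (\<integral>\<^sup>+z. ennreal (4 * (std_normal_density (Re z) * std_normal_density (Im z))) \<partial>lborel)"
    by (intro nn_integral_mono) (simp add: ennreal_mult[symmetric])
  also have "\<dots> < \<infinity>"
    using integrable_mult_right[OF i, of 4] by (subst nn_integral_eq_integral) auto
  finally show ?thesis .
qed

section \<open>Almost sure growth and characteristic functions of the sequence\<close>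

context
  fixes M :: "'a measure" and \<xi> :: "nat \<Rightarrow> 'a \<Rightarrow> complex"
  assumes M: "prob_space M" and iid: "iid_std_complex_gaussian M \<xi>"
begin

interpretation prob_space M by (rule M)

lemma iid_distributed: "distributed M lborel (\<xi> n) (\<lambda>z. ennreal (exp (- (cmod z)\<^sup>2) / pi))"
  using iid by (simp add: iid_std_complex_gaussian_def)

lemma iid_measurable [measurable]: "\<xi> n \<in> borel_measurable M"
  using distributed_measurable[OF iid_distributed[of n]] by simp

text \<open>Applied to the coefficient of index 0, which is G(0): almost surely G is not the zero
  function, and its zero process is meaningful.\<close>

lemma iid_AE_nonzero: "AE \<omega> in M. \<xi> n \<omega> \<noteq> 0"
proof -
  have "emeasure M (\<xi> n -` {0} \<inter> space M) = (\<integral>\<^sup>+z. ennreal (exp (- (cmod z)\<^sup>2) / pi) * indicator {0} z \<partial>lborel)"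
    by (rule distributed_emeasure[OF iid_distributed]) simp
  also have "\<dots> = 0"
    by (subst nn_integral_0_iff_AE) (auto intro!: AE_I'[of "{0}"] simp: indicator_def null_sets_def)
  finally show ?thesis
    by (intro AE_I[of _ _ "\<xi> n -` {0} \<inter> space M"]) auto
qed

text \<open>All |\<xi>_n|^2 have the same finite mean, so \<Sum> |\<xi>_n|^2 / (n + 1)^2 has finite
  expectation and is almost surely finite; its value s bounds every single term, which gives C =
  sqrt s.\<close>

lemma iid_AE_linear_growth: "AE \<omega> in M. linear_growth (\<lambda>n. \<xi> n \<omega>)"
proof -
  define K where "K = (\<integral>\<^sup>+z. ennreal (exp (- (cmod z)\<^sup>2) / pi) * ennreal ((cmod z)\<^sup>2) \<partial>lborel)"
  have K: "(\<integral>\<^sup>+\<omega>. ennreal ((cmod (\<xi> n \<omega>))\<^sup>2) \<partial>M) = K" for n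
    unfolding K_def by (rule distributed_nn_integral[OF iid_distributed, symmetric]) simp
  obtain k where k: "K = ennreal k" "k \<ge> 0"
    using complex_gaussian_second_moment_finite by (cases K) (auto simp: K_def[symmetric])
  let ?c = "\<lambda>n. 1 / (real (n + 1))\<^sup>2"
  define S where "S \<omega> = (\<Sum>n. ennreal (?c n * (cmod (\<xi> n \<omega>))\<^sup>2))" for \<omega>
  have [measurable]: "S \<in> borel_measurable M" unfolding S_def by measurable
  have "(\<integral>\<^sup>+\<omega>. S \<omega> \<partial>M) = (\<Sum>n. \<integral>\<^sup>+\<omega>. ennreal (?c n * (cmod (\<xi> n \<omega>))\<^sup>2) \<partial>M)"
    unfolding S_def by (rule nn_integral_suminf) measurable
  also have "\<dots> = (\<Sum>n. ennreal (?c n * k))"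
  proof (rule suminf_cong)
    fix n
    have "(\<integral>\<^sup>+\<omega>. ennreal (?c n * (cmod (\<xi> n \<omega>))\<^sup>2) \<partial>M) = (\<integral>\<^sup>+\<omega>. ennreal (?c n) * ennreal ((cmod (\<xi> n \<omega>))\<^sup>2) \<partial>M)"
      by (intro nn_integral_cong) (simp add: ennreal_mult[symmetric])
    also have "\<dots> = ennreal (?c n) * K" by (subst nn_integral_cmult) (auto simp: K)
    finally show "(\<integral>\<^sup>+\<omega>. ennreal (?c n * (cmod (\<xi> n \<omega>))\<^sup>2) \<partial>M) = ennreal (?c n * k)"
      using k by (simp add: ennreal_mult[symmetric])
  qed
  also have "\<dots> = ennreal (\<Sum>n. ?c n * k)"
  proof (rule suminf_ennreal2)
    have "summable (\<lambda>n. ?c n)"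
      using inverse_power_summable[of 2, where 'a = real] summable_ignore_initial_segment[of "\<lambda>n. inverse (real n ^ 2)" 1]
      by (simp add: field_simps)
    then show "summable (\<lambda>n. ?c n * k)" by (rule summable_mult2)
  qed (use k in auto)
  finally have "(\<integral>\<^sup>+\<omega>. S \<omega> \<partial>M) \<noteq> \<infinity>" by simp
  then have "AE \<omega> in M. S \<omega> \<noteq> \<infinity>" by (intro nn_integral_PInf_AE) auto
  then show ?thesis
  proof eventually_elim
    case (elim \<omega>)
    then obtain s where s: "S \<omega> = ennreal s" "s \<ge> 0" by (cases "S \<omega>") auto
    have "norm (\<xi> n \<omega>) \<le> sqrt s * real (n + 1)" for n
    proof -
      have "(\<Sum>i<Suc n. ennreal (?c i * (cmod (\<xi> i \<omega>))\<^sup>2)) \<le> S \<omega>"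
        unfolding S_def by (intro sum_le_suminf) auto
      then have "ennreal (?c n * (cmod (\<xi> n \<omega>))\<^sup>2) \<le> S \<omega>"
        by (rule order.trans[rotated]) (simp add: add_increasing)
      then have "?c n * (cmod (\<xi> n \<omega>))\<^sup>2 \<le> s" using s by simp
      then have "(cmod (\<xi> n \<omega>))\<^sup>2 \<le> s * (real (n + 1))\<^sup>2" by (simp add: field_simps)
      then have "sqrt ((cmod (\<xi> n \<omega>))\<^sup>2) \<le> sqrt (s * (real (n + 1))\<^sup>2)" by (simp only: real_sqrt_le_iff)
      then show ?thesis by (simp add: real_sqrt_mult)
    qed
    then show ?case unfolding linear_growth_def by blast
  qed
qed

lemma iid_char_sum:
  "(CLINT \<omega>|M. iexp (\<Sum>n<N. Re (\<beta> n * \<xi> n \<omega>))) = of_real (exp (- (\<Sum>n<N. (cmod (\<beta> n))\<^sup>2) / 4))"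
proof -
  have "indep_vars (\<lambda>_. borel) \<xi> UNIV" using iid by (simp add: iid_std_complex_gaussian_def)
  then have "indep_vars (\<lambda>_. borel) \<xi> {..<N}" by (rule indep_vars_subset) simp
  then have "indep_vars (\<lambda>_. borel) (\<lambda>n \<omega>. Re (\<beta> n * \<xi> n \<omega>)) {..<N}"
    by (rule indep_vars_compose2) measurable
  from char_distr_sum[OF this, of 1]
  have "(CLINT \<omega>|M. iexp (\<Sum>n<N. Re (\<beta> n * \<xi> n \<omega>))) = (\<Prod>n<N. CLINT \<omega>|M. iexp (Re (\<beta> n * \<xi> n \<omega>)))"
    by (simp add: char_def integral_distr)
  also have "\<dots> = (\<Prod>n<N. of_real (exp (- (cmod (\<beta> n))\<^sup>2 / 4)))"
  proof (rule prod.cong[OF refl])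
    fix n
    have "(CLINT \<omega>|M. iexp (Re (\<beta> n * \<xi> n \<omega>))) = (CLINT z|distr M lborel (\<xi> n). iexp (Re (\<beta> n * z)))"
      by (subst integral_distr) auto
    also have "\<dots> = (CLINT z|density lborel (\<lambda>z. ennreal (exp (- (cmod z)\<^sup>2) / pi)). iexp (Re (\<beta> n * z)))"
      by (simp add: distributed_distr_eq_density[OF iid_distributed])
    also have "\<dots> = (CLINT z|lborel. of_real (exp (- (cmod z)\<^sup>2) / pi) * iexp (Re (\<beta> n * z)))"
      by (subst integral_density) (auto simp: scaleR_conv_of_real)
    also have "\<dots> = of_real (exp (- (cmod (\<beta> n))\<^sup>2 / 4))"
      using complex_gaussian_density_exp_Re by (rule has_bochner_integral_integral_eq)
    finally show "(CLINT \<omega>|M. iexp (Re (\<beta> n * \<xi> n \<omega>))) = of_real (exp (- (cmod (\<beta> n))\<^sup>2 / 4))" .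
  qed
  also have "\<dots> = of_real (exp (- (\<Sum>n<N. (cmod (\<beta> n))\<^sup>2) / 4))"
    by (simp add: exp_sum[symmetric] sum_negf sum_divide_distrib flip: of_real_prod)
  finally show ?thesis .
qed

text \<open>Almost sure convergence of the series suffices to pass to the limit, because the
  integrands have modulus 1.\<close>

lemma iid_char_series:
  assumes S: "AE \<omega> in M. (\<lambda>n. \<beta> n * \<xi> n \<omega>) sums S \<omega>" and [measurable]: "S \<in> borel_measurable M"
    and B: "(\<lambda>n. (cmod (\<beta> n))\<^sup>2) sums B"
  shows "(CLINT \<omega>|M. iexp (Re (S \<omega>))) = of_real (exp (- B / 4))"
proof (rule LIMSEQ_unique)
  show "(\<lambda>N. CLINT \<omega>|M. iexp (\<Sum>n<N. Re (\<beta> n * \<xi> n \<omega>))) \<longlonglongrightarrow> (CLINT \<omega>|M. iexp (Re (S \<omega>)))"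
  proof (rule integral_dominated_convergence[where w = "\<lambda>_. 1"])
    show "AE \<omega> in M. (\<lambda>N. iexp (\<Sum>n<N. Re (\<beta> n * \<xi> n \<omega>))) \<longlonglongrightarrow> iexp (Re (S \<omega>))"
      using S
    proof eventually_elim
      case (elim \<omega>)
      then have "(\<lambda>N. Re (\<Sum>n<N. \<beta> n * \<xi> n \<omega>)) \<longlonglongrightarrow> Re (S \<omega>)"
        unfolding sums_def by (rule tendsto_Re)
      then show ?case unfolding Re_sum by (intro tendsto_intros)
    qed
  qed auto
  show "(\<lambda>N. CLINT \<omega>|M. iexp (\<Sum>n<N. Re (\<beta> n * \<xi> n \<omega>))) \<longlonglongrightarrow> of_real (exp (- B / 4))"
    unfolding iid_char_sum using B unfolding sums_def by (intro tendsto_intros) auto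
qed

end

section \<open>Characteristic functions determine finite-dimensional distributions\<close>

context prob_space
begin

text \<open>Dividing the weight by its integral c turns it into a probability density, and Levy's
  theorem applies to the law of X under it. The transforms at s = 0 show that both weights have the
  same integral.\<close>

lemma weighted_char_unique:
  fixes W W' X X' :: "'a \<Rightarrow> real"
  assumes [measurable]: "W \<in> borel_measurable M" "W' \<in> borel_measurable M"
      "X \<in> borel_measurable M" "X' \<in> borel_measurable M"
    and W: "\<And>\<omega>. 0 \<le> W \<omega>" "\<And>\<omega>. W \<omega> \<le> b" and W': "\<And>\<omega>. 0 \<le> W' \<omega>" "\<And>\<omega>. W' \<omega> \<le> b"
    and eq: "\<And>s. (CLINT \<omega>|M. of_real (W \<omega>) * iexp (s * X \<omega>)) = (CLINT \<omega>|M. of_real (W' \<omega>) * iexp (s * X' \<omega>))"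
    and B: "B \<in> sets borel"
  shows "(\<integral>\<omega>. W \<omega> * indicator B (X \<omega>) \<partial>M) = (\<integral>\<omega>. W' \<omega> * indicator B (X' \<omega>) \<partial>M)"
proof -
  have int: "integrable M V" if "V \<in> borel_measurable M" "\<And>\<omega>. 0 \<le> V \<omega>" "\<And>\<omega>. V \<omega> \<le> b" for V :: "'a \<Rightarrow> real"
    using that by (intro integrable_const_bound[of _ b]) auto
  define c where "c = (\<integral>\<omega>. W \<omega> \<partial>M)"
  have c': "(\<integral>\<omega>. W' \<omega> \<partial>M) = c"
  proof -
    have "complex_of_real (\<integral>\<omega>. W' \<omega> \<partial>M) = complex_of_real (\<integral>\<omega>. W \<omega> \<partial>M)"
      using eq[of 0] by simp
    then show ?thesis by (simp only: of_real_eq_iff c_def)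
  qed
  have c0: "c \<ge> 0" unfolding c_def using W by (intro integral_nonneg_AE) auto
  define D where "D V Y = distr (density M (\<lambda>\<omega>. ennreal (V \<omega> / c))) borel Y" for V Y :: "'a \<Rightarrow> real"
  show ?thesis
  proof (cases "c = 0")
    \<comment> \<open>Nothing can be normalized here, but a nonnegative weight of integral 0
      vanishes almost surely and both sides are 0.\<close>
    case True
    have "(\<integral>\<omega>. V \<omega> * indicator B (Y \<omega>) \<partial>M) = 0"
      if [measurable]: "V \<in> borel_measurable M" "Y \<in> borel_measurable M"
        and V: "\<And>\<omega>. 0 \<le> V \<omega>" "\<And>\<omega>. V \<omega> \<le> b" and "(\<integral>\<omega>. V \<omega> \<partial>M) = c" for V Y :: "'a \<Rightarrow> real"
    proof -
      have "AE \<omega> in M. V \<omega> = 0"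
        using integral_nonneg_eq_0_iff_AE[of M V] int[of V] that True by auto
      then have "AE \<omega> in M. V \<omega> * indicator B (Y \<omega>) = 0" by eventually_elim simp
      then show ?thesis by (rule integral_eq_zero_AE)
    qed
    then show ?thesis using W W' c' by (simp add: c_def)
  next
    case False
    with c0 have c: "c > 0" by simp
    have D: "real_distribution (D V Y)"
        "char (D V Y) s = (CLINT \<omega>|M. of_real (V \<omega>) * iexp (s * Y \<omega>)) / of_real c"
        "measure (D V Y) B = (\<integral>\<omega>. V \<omega> * indicator B (Y \<omega>) \<partial>M) / c"
      if [measurable]: "V \<in> borel_measurable M" "Y \<in> borel_measurable M"
        and V: "\<And>\<omega>. 0 \<le> V \<omega>" "\<And>\<omega>. V \<omega> \<le> b" and Vc: "(\<integral>\<omega>. V \<omega> \<partial>M) = c" for V Y s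
    proof -
      have Vi: "integrable M V" by (intro int V) simp
      have "emeasure (density M (\<lambda>\<omega>. ennreal (V \<omega> / c))) (space M) = (\<integral>\<^sup>+\<omega>. ennreal (V \<omega> / c) \<partial>M)"
        by (subst emeasure_density) (auto intro!: nn_integral_cong)
      also have "\<dots> = ennreal (\<integral>\<omega>. V \<omega> / c \<partial>M)"
        using Vi V c by (intro nn_integral_eq_integral) auto
      also have "\<dots> = 1" using Vc c by simp
      finally interpret P: prob_space "density M (\<lambda>\<omega>. ennreal (V \<omega> / c))"
        by (intro prob_spaceI) simp
      have Y: "Y \<in> density M (\<lambda>\<omega>. ennreal (V \<omega> / c)) \<rightarrow>\<^sub>M borel" by simp
      show "real_distribution (D V Y)"
        unfolding D_def by (rule P.real_distribution_distr) (use Y in simp)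
      have "char (D V Y) s = (CLINT \<omega>|density M (\<lambda>\<omega>. ennreal (V \<omega> / c)). iexp (s * Y \<omega>))"
        unfolding char_def D_def by (subst integral_distr) auto
      also have "\<dots> = (CLINT \<omega>|M. of_real (V \<omega>) * iexp (s * Y \<omega>) / of_real c)"
        using V c by (subst integral_density) (auto simp: scaleR_conv_of_real)
      finally show "char (D V Y) s = (CLINT \<omega>|M. of_real (V \<omega>) * iexp (s * Y \<omega>)) / of_real c" by simp
      have "measure (D V Y) B = (\<integral>x. indicator B x \<partial>D V Y)"
        using B by (simp add: D_def)
      also have "\<dots> = (\<integral>\<omega>. indicator B (Y \<omega>) \<partial>density M (\<lambda>\<omega>. ennreal (V \<omega> / c)))"
        unfolding D_def using B by (subst integral_distr) auto
      also have "\<dots> = (\<integral>\<omega>. V \<omega> * indicator B (Y \<omega>) / c \<partial>M)"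
        using V c B by (subst integral_density) auto
      finally show "measure (D V Y) B = (\<integral>\<omega>. V \<omega> * indicator B (Y \<omega>) \<partial>M) / c" by simp
    qed
    have "D W X = D W' X'"
    proof (rule Levy_uniqueness)
      show "char (D W X) = char (D W' X')"
        using W W' c' eq by (auto simp: D(2) c_def[symmetric])
    qed (use W W' c' in \<open>auto simp: c_def[symmetric] intro!: D(1)\<close>)
    then show ?thesis
      using D(3)[of W X] D(3)[of W' X'] W W' c' c by (simp add: c_def[symmetric])
  qed
qed

text \<open>A complex weight \<open>iexp \<circ> \<theta>\<close> is a combination of the nonnegative weights \<open>1\<close>,
  \<open>1 + cos \<circ> \<theta>\<close> and \<open>1 + sin \<circ> \<theta>\<close>, to which the uniqueness theorem for
  probability measures on the line applies.\<close>

lemma weighted_char_unique_complex: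
  fixes W W' X X' \<theta> \<theta>' :: "'a \<Rightarrow> real"
  assumes [measurable]: "W \<in> borel_measurable M" "W' \<in> borel_measurable M"
      "X \<in> borel_measurable M" "X' \<in> borel_measurable M" "\<theta> \<in> borel_measurable M" "\<theta>' \<in> borel_measurable M"
    and W: "\<And>\<omega>. 0 \<le> W \<omega>" "\<And>\<omega>. W \<omega> \<le> 1" and W': "\<And>\<omega>. 0 \<le> W' \<omega>" "\<And>\<omega>. W' \<omega> \<le> 1"
    and eq: "\<And>r s. (CLINT \<omega>|M. of_real (W \<omega>) * iexp (r * \<theta> \<omega> + s * X \<omega>)) = (CLINT \<omega>|M. of_real (W' \<omega>) * iexp (r * \<theta>' \<omega> + s * X' \<omega>))"
    and B [measurable]: "B \<in> sets borel"
  shows "(CLINT \<omega>|M. of_real (W \<omega> * indicator B (X \<omega>)) * iexp (\<theta> \<omega>)) = (CLINT \<omega>|M. of_real (W' \<omega> * indicator B (X' \<omega>)) * iexp (\<theta>' \<omega>))"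
proof -
  have ci: "integrable M (\<lambda>\<omega>. of_real (V \<omega>) * iexp (\<phi> \<omega>))"
    if [measurable]: "V \<in> borel_measurable M" "\<phi> \<in> borel_measurable M" and "\<And>\<omega>. 0 \<le> V \<omega>" "\<And>\<omega>. V \<omega> \<le> 1" for V \<phi> :: "'a \<Rightarrow> real"
    using that by (intro integrable_const_bound[of _ 1]) (auto simp: norm_mult)
  have ri: "integrable M (\<lambda>\<omega>. V \<omega> * f (\<phi> \<omega>))"
    if [measurable]: "V \<in> borel_measurable M" "\<phi> \<in> borel_measurable M" "f \<in> borel_measurable borel" and "\<And>\<omega>. 0 \<le> V \<omega>" "\<And>\<omega>. V \<omega> \<le> 1" "\<And>x. \<bar>f x\<bar> \<le> 1" for V \<phi> :: "'a \<Rightarrow> real" and f :: "real \<Rightarrow> real"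
    using that by (intro integrable_const_bound[of _ 1]) (auto simp: abs_mult intro!: mult_le_one)
  have cosx: "(CLINT \<omega>|M. of_real (V \<omega> * (1 + cos (\<phi> \<omega>))) * iexp (s * Y \<omega>))
      = (CLINT \<omega>|M. of_real (V \<omega>) * iexp (0 * \<phi> \<omega> + s * Y \<omega>))
        + ((CLINT \<omega>|M. of_real (V \<omega>) * iexp (1 * \<phi> \<omega> + s * Y \<omega>)) + (CLINT \<omega>|M. of_real (V \<omega>) * iexp ((-1) * \<phi> \<omega> + s * Y \<omega>))) / 2"
    and sinx: "(CLINT \<omega>|M. of_real (V \<omega> * (1 + sin (\<phi> \<omega>))) * iexp (s * Y \<omega>))
      = (CLINT \<omega>|M. of_real (V \<omega>) * iexp (0 * \<phi> \<omega> + s * Y \<omega>))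
        + ((CLINT \<omega>|M. of_real (V \<omega>) * iexp (1 * \<phi> \<omega> + s * Y \<omega>)) - (CLINT \<omega>|M. of_real (V \<omega>) * iexp ((-1) * \<phi> \<omega> + s * Y \<omega>))) / (2 * \<i>)"
    if [measurable]: "V \<in> borel_measurable M" "\<phi> \<in> borel_measurable M" "Y \<in> borel_measurable M" and V: "\<And>\<omega>. 0 \<le> V \<omega>" "\<And>\<omega>. V \<omega> \<le> 1" for V \<phi> Y s
  proof -
    have i: "integrable M (\<lambda>\<omega>. of_real (V \<omega>) * iexp (r * \<phi> \<omega> + s * Y \<omega>))" for r
      using V by (intro ci) auto
    have c: "of_real (cos x) = (iexp x + iexp (- x)) / 2" "of_real (sin x) = (iexp x - iexp (- x)) / (2 * \<i>)" for x
      by (simp_all add: cos_exp_eq sin_exp_eq flip: cos_of_real sin_of_real)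
    have "of_real (V \<omega> * (1 + cos (\<phi> \<omega>))) * iexp (s * Y \<omega>) = of_real (V \<omega>) * iexp (0 * \<phi> \<omega> + s * Y \<omega>)
       + (of_real (V \<omega>) * iexp (1 * \<phi> \<omega> + s * Y \<omega>) + of_real (V \<omega>) * iexp ((-1) * \<phi> \<omega> + s * Y \<omega>)) / 2" for \<omega>
      unfolding of_real_mult of_real_add c by (simp add: distrib_left exp_add exp_diff exp_minus field_simps)
    then show "(CLINT \<omega>|M. of_real (V \<omega> * (1 + cos (\<phi> \<omega>))) * iexp (s * Y \<omega>))
      = (CLINT \<omega>|M. of_real (V \<omega>) * iexp (0 * \<phi> \<omega> + s * Y \<omega>))
        + ((CLINT \<omega>|M. of_real (V \<omega>) * iexp (1 * \<phi> \<omega> + s * Y \<omega>)) + (CLINT \<omega>|M. of_real (V \<omega>) * iexp ((-1) * \<phi> \<omega> + s * Y \<omega>))) / 2"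
      by (simp only: i Bochner_Integration.integral_add Bochner_Integration.integrable_add integrable_divide integral_divide_zero)
    have "of_real (V \<omega> * (1 + sin (\<phi> \<omega>))) * iexp (s * Y \<omega>) = of_real (V \<omega>) * iexp (0 * \<phi> \<omega> + s * Y \<omega>)
       + (of_real (V \<omega>) * iexp (1 * \<phi> \<omega> + s * Y \<omega>) - of_real (V \<omega>) * iexp ((-1) * \<phi> \<omega> + s * Y \<omega>)) / (2 * \<i>)" for \<omega>
      unfolding of_real_mult of_real_add c by (simp add: distrib_left exp_add exp_diff exp_minus field_simps)
    then show "(CLINT \<omega>|M. of_real (V \<omega> * (1 + sin (\<phi> \<omega>))) * iexp (s * Y \<omega>))
      = (CLINT \<omega>|M. of_real (V \<omega>) * iexp (0 * \<phi> \<omega> + s * Y \<omega>))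
        + ((CLINT \<omega>|M. of_real (V \<omega>) * iexp (1 * \<phi> \<omega> + s * Y \<omega>)) - (CLINT \<omega>|M. of_real (V \<omega>) * iexp ((-1) * \<phi> \<omega> + s * Y \<omega>))) / (2 * \<i>)"
      by (simp only: i Bochner_Integration.integral_add Bochner_Integration.integral_diff Bochner_Integration.integrable_diff Bochner_Integration.integrable_add integrable_divide integral_divide_zero)
  qed
  have le2: "V * (1 + u) \<le> 2" "0 \<le> V * (1 + u)" if "0 \<le> V" "V \<le> 1" "-1 \<le> u" "u \<le> 1" for V u :: real
    using mult_mono[of V 1 "1 + u" 2] that by auto
  have 1: "(\<integral>\<omega>. W \<omega> * indicator B (X \<omega>) \<partial>M) = (\<integral>\<omega>. W' \<omega> * indicator B (X' \<omega>) \<partial>M)"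
    by (rule weighted_char_unique[where b = 1]) (use W W' B eq[of 0] in auto)
  have cos2: "(CLINT \<omega>|M. of_real (W \<omega> * (1 + cos (\<theta> \<omega>))) * iexp (s * X \<omega>)) = (CLINT \<omega>|M. of_real (W' \<omega> * (1 + cos (\<theta>' \<omega>))) * iexp (s * X' \<omega>))"
    and sin2: "(CLINT \<omega>|M. of_real (W \<omega> * (1 + sin (\<theta> \<omega>))) * iexp (s * X \<omega>)) = (CLINT \<omega>|M. of_real (W' \<omega> * (1 + sin (\<theta>' \<omega>))) * iexp (s * X' \<omega>))" for s
    unfolding cosx[OF assms(1,5,3) W] cosx[OF assms(2,6,4) W'] sinx[OF assms(1,5,3) W] sinx[OF assms(2,6,4) W'] eq by (rule refl)+
  have 2: "(\<integral>\<omega>. W \<omega> * (1 + cos (\<theta> \<omega>)) * indicator B (X \<omega>) \<partial>M) = (\<integral>\<omega>. W' \<omega> * (1 + cos (\<theta>' \<omega>)) * indicator B (X' \<omega>) \<partial>M)"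
    by (rule weighted_char_unique[where b = 2])
      (use W W' B cos2 in \<open>auto intro!: le2 simp del: of_real_mult of_real_add of_real_1\<close>)
  have 3: "(\<integral>\<omega>. W \<omega> * (1 + sin (\<theta> \<omega>)) * indicator B (X \<omega>) \<partial>M) = (\<integral>\<omega>. W' \<omega> * (1 + sin (\<theta>' \<omega>)) * indicator B (X' \<omega>) \<partial>M)"
    by (rule weighted_char_unique[where b = 2])
      (use W W' B sin2 in \<open>auto intro!: le2 simp del: of_real_mult of_real_add of_real_1\<close>)
  have split: "(CLINT \<omega>|M. of_real (V \<omega> * indicator B (Y \<omega>)) * iexp (\<phi> \<omega>))
      = of_real ((\<integral>\<omega>. V \<omega> * (1 + cos (\<phi> \<omega>)) * indicator B (Y \<omega>) \<partial>M) - (\<integral>\<omega>. V \<omega> * indicator B (Y \<omega>) \<partial>M))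
        + \<i> * of_real ((\<integral>\<omega>. V \<omega> * (1 + sin (\<phi> \<omega>)) * indicator B (Y \<omega>) \<partial>M) - (\<integral>\<omega>. V \<omega> * indicator B (Y \<omega>) \<partial>M))"
    if [measurable]: "V \<in> borel_measurable M" "\<phi> \<in> borel_measurable M" "Y \<in> borel_measurable M" and V: "\<And>\<omega>. 0 \<le> V \<omega>" "\<And>\<omega>. V \<omega> \<le> 1" for V \<phi> Y
  proof -
    let ?U = "\<lambda>\<omega>. V \<omega> * indicator B (Y \<omega>)"
    have U: "0 \<le> ?U \<omega>" "?U \<omega> \<le> 1" for \<omega> using V by (auto simp: indicator_def)
    have i0: "integrable M ?U" using ri[of ?U "\<lambda>_. 0" "\<lambda>_. 1"] U by simp
    have ic: "integrable M (\<lambda>\<omega>. ?U \<omega> * cos (\<phi> \<omega>))" and isn: "integrable M (\<lambda>\<omega>. ?U \<omega> * sin (\<phi> \<omega>))"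
      using U by (intro ri; auto)+
    have c: "(\<integral>\<omega>. V \<omega> * (1 + cos (\<phi> \<omega>)) * indicator B (Y \<omega>) \<partial>M) = (\<integral>\<omega>. ?U \<omega> \<partial>M) + (\<integral>\<omega>. ?U \<omega> * cos (\<phi> \<omega>) \<partial>M)"
      using i0 ic by (subst Bochner_Integration.integral_add[symmetric]) (auto intro!: Bochner_Integration.integral_cong simp: algebra_simps)
    have s: "(\<integral>\<omega>. V \<omega> * (1 + sin (\<phi> \<omega>)) * indicator B (Y \<omega>) \<partial>M) = (\<integral>\<omega>. ?U \<omega> \<partial>M) + (\<integral>\<omega>. ?U \<omega> * sin (\<phi> \<omega>) \<partial>M)"
      using i0 isn by (subst Bochner_Integration.integral_add[symmetric]) (auto intro!: Bochner_Integration.integral_cong simp: algebra_simps)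
    have "(CLINT \<omega>|M. of_real (?U \<omega>) * iexp (\<phi> \<omega>)) = (CLINT \<omega>|M. of_real (?U \<omega> * cos (\<phi> \<omega>)) + \<i> * of_real (?U \<omega> * sin (\<phi> \<omega>)))"
      by (intro Bochner_Integration.integral_cong refl) (simp add: exp_Euler algebra_simps flip: cos_of_real sin_of_real)
    also have "\<dots> = of_real (\<integral>\<omega>. ?U \<omega> * cos (\<phi> \<omega>) \<partial>M) + \<i> * of_real (\<integral>\<omega>. ?U \<omega> * sin (\<phi> \<omega>) \<partial>M)"
      using ic isn by (subst Bochner_Integration.integral_add) (auto simp del: of_real_mult)
    finally show ?thesis unfolding c s by simp
  qed
  show ?thesis
    using W W' by (simp only: split assms(1-6) 1 2 3)
qed

lemma char_determines_fdd:
  fixes X Y :: "'i \<Rightarrow> 'a \<Rightarrow> real"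
  assumes [measurable]: "\<And>i. X i \<in> borel_measurable M" "\<And>i. Y i \<in> borel_measurable M"
    and eq: "\<And>J t. finite J \<Longrightarrow> (CLINT \<omega>|M. iexp (\<Sum>i\<in>J. t i * X i \<omega>)) = (CLINT \<omega>|M. iexp (\<Sum>i\<in>J. t i * Y i \<omega>))"
    and F: "finite F" and B: "\<And>i. i \<in> F \<Longrightarrow> B i \<in> sets borel"
  shows "emeasure M {\<omega>\<in>space M. \<forall>i\<in>F. X i \<omega> \<in> B i} = emeasure M {\<omega>\<in>space M. \<forall>i\<in>F. Y i \<omega> \<in> B i}"
proof -
  \<comment> \<open>The induction runs over mixed transforms, with indicators for the coordinates in
    F and characters for those in J. Empty F is the hypothesis and empty J the claim; each step
    trades the character of one coordinate for its indicator.\<close>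
  define P where "P Z F = (\<lambda>\<omega>. \<Prod>i\<in>F. indicator (B i) (Z i \<omega>) :: real)" for Z :: "'i \<Rightarrow> 'a \<Rightarrow> real" and F
  have "finite J \<Longrightarrow> (CLINT \<omega>|M. of_real (P X F \<omega>) * iexp (\<Sum>i\<in>J. t i * X i \<omega>)) = (CLINT \<omega>|M. of_real (P Y F \<omega>) * iexp (\<Sum>i\<in>J. t i * Y i \<omega>))" for J t
    using F B
  proof (induction F arbitrary: J t)
    case empty
    then show ?case using eq by (simp add: P_def)
  next
    case (insert j F)
    have [measurable]: "B i \<in> sets borel" if "i \<in> F" for i using insert.prems that by auto
    have bj: "B j \<in> sets borel" using insert.prems by auto
    have P01: "0 \<le> P Z F \<omega>" "P Z F \<omega> \<le> 1" for Z \<omega>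
      unfolding P_def by (auto intro!: prod_nonneg prod_le_1)
    have Pm [measurable]: "P Z F \<in> borel_measurable M" if "\<And>i. Z i \<in> borel_measurable M" for Z
      unfolding P_def by (intro borel_measurable_prod measurable_compose[OF that] borel_measurable_indicator) measurable
    \<comment> \<open>The new coordinate \<open>j\<close> may already occur in J, so its coefficient
      collects two contributions.\<close>
    have lin: "r * (\<Sum>i\<in>J. t i * Z i \<omega>) + s * Z j \<omega> = (\<Sum>i\<in>insert j J. (r * (if i \<in> J then t i else 0) + s * (if i = j then 1 else 0)) * Z i \<omega>)"
      for r s Z \<omega>
    proof -
      have "(\<Sum>i\<in>insert j J. (r * (if i \<in> J then t i else 0) + s * (if i = j then 1 else 0)) * Z i \<omega>)
          = (\<Sum>i\<in>insert j J. (if i \<in> J then r * (t i * Z i \<omega>) else 0)) + (\<Sum>i\<in>insert j J. (if i = j then s * Z i \<omega> else 0))"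
        by (subst sum.distrib[symmetric], rule sum.cong) (auto simp: algebra_simps)
      also have "(\<Sum>i\<in>insert j J. (if i = j then s * Z i \<omega> else 0)) = s * Z j \<omega>"
        using insert.prems(1) by (subst sum.delta) auto
      also have "(\<Sum>i\<in>insert j J. (if i \<in> J then r * (t i * Z i \<omega>) else 0)) = (\<Sum>i\<in>J. r * (t i * Z i \<omega>))"
        using insert.prems(1) by (intro sum.mono_neutral_cong_right) auto
      finally show ?thesis by (simp add: sum_distrib_left)
    qed
    have "(CLINT \<omega>|M. of_real (P X F \<omega> * indicator (B j) (X j \<omega>)) * iexp (\<Sum>i\<in>J. t i * X i \<omega>))
        = (CLINT \<omega>|M. of_real (P Y F \<omega> * indicator (B j) (Y j \<omega>)) * iexp (\<Sum>i\<in>J. t i * Y i \<omega>))"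
    proof (rule weighted_char_unique_complex)
      show "(CLINT \<omega>|M. of_real (P X F \<omega>) * iexp (r * (\<Sum>i\<in>J. t i * X i \<omega>) + s * X j \<omega>))
          = (CLINT \<omega>|M. of_real (P Y F \<omega>) * iexp (r * (\<Sum>i\<in>J. t i * Y i \<omega>) + s * Y j \<omega>))" for r s
        unfolding lin by (rule insert.IH) (use insert.prems in auto)
    qed (use P01 bj in \<open>auto intro!: Pm\<close>)
    then show ?case
      using insert.hyps by (simp add: P_def mult.commute)
  qed
  from this[of "{}"] have "(CLINT \<omega>|M. of_real (P X F \<omega>)) = (CLINT \<omega>|M. of_real (P Y F \<omega>))" by simp
  then have "(\<integral>\<omega>. P X F \<omega> \<partial>M) = (\<integral>\<omega>. P Y F \<omega> \<partial>M)" by (simp add: of_real_eq_iff)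
  moreover have "(\<integral>\<omega>. P Z F \<omega> \<partial>M) = measure M {\<omega>\<in>space M. \<forall>i\<in>F. Z i \<omega> \<in> B i}"
    if Z: "\<And>i. Z i \<in> borel_measurable M" for Z
  proof -
    have "P Z F \<omega> = indicator {\<omega>\<in>space M. \<forall>i\<in>F. Z i \<omega> \<in> B i} \<omega>" if "\<omega> \<in> space M" for \<omega>
      using F that by (auto simp: P_def indicator_def prod_zero_iff)
    then have "(\<integral>\<omega>. P Z F \<omega> \<partial>M) = (\<integral>\<omega>. indicator {\<omega>\<in>space M. \<forall>i\<in>F. Z i \<omega> \<in> B i} \<omega> \<partial>M)"
      by (intro Bochner_Integration.integral_cong) auto
    also have "\<dots> = measure M {\<omega>\<in>space M. \<forall>i\<in>F. Z i \<omega> \<in> B i}"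
      by (simp add: Int_absorb2 Collect_restrict)
    finally show ?thesis .
  qed
  ultimately show ?thesis by (simp add: emeasure_eq_measure)
qed

end

section \<open>The Borel sets of the space of entire functions\<close>

text \<open>A Taylor section whose coefficients are moved into the dense set \<open>D\<close>. The
  truncation error and the error of the moved coefficients each get half of \<open>d\<close>. For
  countable \<open>D\<close> only countably many polynomials arise.\<close>

lemma entire_polynomial_approx:
  assumes f: "f holomorphic_on UNIV" and d: "d > 0"
    and D: "\<And>X. open X \<Longrightarrow> X \<noteq> {} \<Longrightarrow> \<exists>x\<in>D. x \<in> (X :: complex set)"
  obtains cs where "cs \<in> lists D" "\<And>z. z \<in> ball 0 R \<Longrightarrow> dist (f z) (\<Sum>i<length cs. cs ! i * z ^ i) \<le> d"
proof -
  define c where "c n = (deriv ^^ n) f 0 / fact n" for n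
  define r where "r = \<bar>R\<bar>"
  have s: "(\<lambda>n. c n * z ^ n) sums f z" for z
    using holomorphic_power_series[of f 0 "norm z + 1" z] f
    by (auto simp: c_def intro: holomorphic_on_subset)
  have sn: "summable (\<lambda>n. norm (c n * of_real r ^ n))"
    by (rule powser_insidea[where x = "of_real (r + 1)"]) (use s in \<open>auto simp: sums_iff r_def\<close>)
  then have sn': "summable (\<lambda>n. norm (c n) * r ^ n)"
    by (simp add: norm_mult norm_power r_def)
  obtain N where N: "norm (\<Sum>i. norm (c (i + N)) * r ^ (i + N)) < d / 2"
    using suminf_exist_split[OF _ sn', of "d / 2"] d by auto
  \<comment> \<open>This radius keeps the error of each of the N terms below d / (2 (N + 1)) for |z|
    \<le> r; the added 1s keep the denominators positive.\<close>
  have "\<exists>x\<in>D. x \<in> ball (c i) (d / (2 * (real N + 1) * (r ^ i + 1)))" for i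
  proof -
    have "0 < d / (2 * (real N + 1) * (r ^ i + 1))"
      by (intro divide_pos_pos d mult_pos_pos add_nonneg_pos) (auto simp: r_def)
    then show ?thesis using D[OF open_ball, of "c i" "d / (2 * (real N + 1) * (r ^ i + 1))"] by simp
  qed
  then obtain a where a: "\<And>i. a i \<in> D" "\<And>i. dist (c i) (a i) < d / (2 * (real N + 1) * (r ^ i + 1))"
    by (metis mem_ball)
  show ?thesis
  proof (rule that[of "map a [0..<N]"])
    show "map a [0..<N] \<in> lists D" using a by auto
    fix z :: complex assume "z \<in> ball 0 R"
    then have z: "norm z \<le> r" by (simp add: r_def)
    have tail: "summable (\<lambda>i. norm (c (i + N) * z ^ (i + N)))"
      by (rule summable_comparison_test'[OF summable_ignore_initial_segment[OF sn', of N]])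
        (use z in \<open>auto simp: norm_mult norm_power intro!: mult_left_mono power_mono\<close>)
    have "f z = (\<Sum>i. c (i + N) * z ^ (i + N)) + (\<Sum>i<N. c i * z ^ i)"
      using suminf_split_initial_segment[of "\<lambda>i. c i * z ^ i" N] s[of z] by (auto simp: sums_iff)
    then have "f z - (\<Sum>i<N. a i * z ^ i) = (\<Sum>i. c (i + N) * z ^ (i + N)) + (\<Sum>i<N. (c i - a i) * z ^ i)"
      by (simp add: algebra_simps sum_subtractf)
    then have "dist (f z) (\<Sum>i<N. a i * z ^ i) \<le> norm (\<Sum>i. c (i + N) * z ^ (i + N)) + norm (\<Sum>i<N. (c i - a i) * z ^ i)"
      by (simp add: dist_norm norm_triangle_ineq)
    also have "norm (\<Sum>i. c (i + N) * z ^ (i + N)) \<le> (\<Sum>i. norm (c (i + N) * z ^ (i + N)))"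
      by (rule summable_norm[OF tail])
    also have "\<dots> \<le> (\<Sum>i. norm (c (i + N)) * r ^ (i + N))"
      using z by (intro suminf_le tail summable_ignore_initial_segment[OF sn'])
        (auto simp: norm_mult norm_power intro!: mult_left_mono power_mono)
    also have "\<dots> \<le> d / 2" using N unfolding real_norm_def by linarith
    also have "norm (\<Sum>i<N. (c i - a i) * z ^ i) \<le> (\<Sum>i<N. d / (2 * (real N + 1)))"
    proof (rule order.trans[OF norm_sum sum_mono])
      fix i
      have rp: "r ^ i + 1 > 0" by (simp add: r_def add_nonneg_pos)
      have "norm ((c i - a i) * z ^ i) \<le> (d / (2 * (real N + 1) * (r ^ i + 1))) * (r ^ i + 1)"
        unfolding norm_mult norm_power
        using a(2)[of i] power_mono[OF z norm_ge_zero, of i] d rp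
        by (intro mult_mono) (auto simp: dist_norm intro!: divide_nonneg_nonneg mult_nonneg_nonneg simp del: mult_pos_pos)
      also have "\<dots> = d / (2 * (real N + 1))" using rp by simp
      finally show "norm ((c i - a i) * z ^ i) \<le> d / (2 * (real N + 1))" .
    qed
    also have "\<dots> \<le> d / 2" using d by (simp add: field_simps)
    finally show "dist (f z) (\<Sum>i<length (map a [0..<N]). map a [0..<N] ! i * z ^ i) \<le> d" by simp
  qed
qed

section \<open>Cylinder sets and the sigma-algebra generated by evaluations\<close>

abbreviation entire :: "(complex \<Rightarrow> complex) set" where
  "entire \<equiv> {f. f holomorphic_on UNIV}"

text \<open>Point values are split into real parts (\<open>True\<close>) and imaginary parts
  (\<open>False\<close>), because the uniqueness theorem for characteristic functions is stated for
  real families.\<close>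

definition coord :: "complex \<times> bool \<Rightarrow> (complex \<Rightarrow> complex) \<Rightarrow> real" where
  "coord i f = (if snd i then Re (f (fst i)) else Im (f (fst i)))"

definition entire_cylinders :: "(complex \<Rightarrow> complex) set set" where
  "entire_cylinders = {{f \<in> entire. \<forall>i\<in>F. coord i f \<in> B i} | F B. finite F \<and> (\<forall>i. B i \<in> sets borel)}"

lemma entire_cylindersI:
  "finite F \<Longrightarrow> (\<And>i. B i \<in> sets borel) \<Longrightarrow> {f \<in> entire. \<forall>i\<in>F. coord i f \<in> B i} \<in> entire_cylinders"
  unfolding entire_cylinders_def by blast

lemma entire_cylinders_subset: "entire_cylinders \<subseteq> Pow entire"
  by (auto simp: entire_cylinders_def)

lemma space_entire_borel [simp]: "space entire_borel = entire"
  by (auto simp: entire_borel_def space_measure_of_conv)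

lemma sets_entire_borel_open: "sets entire_borel = sigma_sets entire (Collect open_entire)"
  unfolding entire_borel_def by (rule sets_measure_of) (auto simp: open_entire_def)

lemma measurable_coord_cylinders: "coord i \<in> borel_measurable (sigma entire entire_cylinders)"
proof (rule measurableI)
  fix A :: "real set" assume A: "A \<in> sets borel"
  have "coord i -` A \<inter> entire = {f \<in> entire. \<forall>j\<in>{i}. coord j f \<in> A}" by auto
  also have "\<dots> \<in> entire_cylinders" using A by (intro entire_cylindersI) auto
  finally show "coord i -` A \<inter> space (sigma entire entire_cylinders) \<in> sets (sigma entire entire_cylinders)"
    using entire_cylinders_subset by (simp add: sets_measure_of space_measure_of_conv sigma_sets.Basic)
qed simp

lemma measurable_eval_cylinders [measurable]: "(\<lambda>f. f z) \<in> borel_measurable (sigma entire entire_cylinders)"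
proof -
  have "(\<lambda>f. Complex (coord (z, True) f) (coord (z, False) f)) \<in> borel_measurable (sigma entire entire_cylinders)"
    using measurable_coord_cylinders[measurable] by (simp add: Complex_eq)
  then show ?thesis by (simp add: coord_def)
qed

text \<open>Second countability at work: an open set is the countable union of those closed uniform
  neighbourhoods \<open>Bs\<close> of polynomials with coefficients in D that it contains.\<close>

lemma open_entire_in_cylinders:
  assumes U: "open_entire U"
  shows "U \<in> sets (sigma entire entire_cylinders)"
proof -
  let ?S = "sigma entire entire_cylinders"
  have sp: "space ?S = entire" using entire_cylinders_subset by (simp add: space_measure_of_conv)
  obtain D :: "complex set" where D: "countable D" "\<And>X. open X \<Longrightarrow> X \<noteq> {} \<Longrightarrow> \<exists>x\<in>D. x \<in> X"
    using countable_dense_exists by metis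
  define p where "p cs z = (\<Sum>i<length cs. cs ! i * z ^ i)" for cs and z :: complex
  define Bs where "Bs = (\<lambda>(cs, n, k). {g \<in> entire. \<forall>z\<in>ball 0 (real n). dist (g z) (p cs z) \<le> 1 / real (Suc k)})"
  have B: "Bs x \<in> sets ?S" for x
  proof -
    obtain cs n k where x: "x = (cs, n, k)" by (cases x)
    \<comment> \<open>By continuity the uniform estimate needs checking only on the countable dense
      set, hence by countably many evaluations.\<close>
    have "Bs x = {g \<in> space ?S. \<forall>z\<in>D \<inter> ball 0 (real n). dist (g z) (p cs z) \<le> 1 / real (Suc k)}"
    proof (intro set_eqI iffI)
      fix g assume g: "g \<in> {g \<in> space ?S. \<forall>z\<in>D \<inter> ball 0 (real n). dist (g z) (p cs z) \<le> 1 / real (Suc k)}"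
      have "continuous_on UNIV g" using g sp by (auto intro: holomorphic_on_imp_continuous_on)
      then have "open {z. 1 / real (Suc k) < dist (g z) (p cs z)}"
        unfolding p_def by (intro open_Collect_less continuous_intros)
      then have "open (ball 0 (real n) \<inter> {z. 1 / real (Suc k) < dist (g z) (p cs z)})" by auto
      from D(2)[OF this] g have "ball 0 (real n) \<inter> {z. 1 / real (Suc k) < dist (g z) (p cs z)} = {}" by force
      then show "g \<in> Bs x" using g sp by (force simp: Bs_def x)
    qed (auto simp: Bs_def x sp)
    also have "\<dots> \<in> sets ?S"
      using D(1) by (intro sets.sets_Collect_countable_All' countable_Int1) auto
    finally show ?thesis .
  qed
  define I where "I = {x \<in> lists D \<times> (UNIV :: nat set) \<times> (UNIV :: nat set). Bs x \<subseteq> U}"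
  have "countable I"
    unfolding I_def using D(1) by (intro countable_Collect countable_SIGMA countable_lists) auto
  then have "(\<Union>x\<in>I. Bs x) \<in> sets ?S" using B by (intro sets.countable_UN') auto
  also have "(\<Union>x\<in>I. Bs x) = U"
  proof (intro equalityI subsetI)
    fix f assume f: "f \<in> U"
    obtain K e where K: "compact K" "e > 0" "{g. g holomorphic_on UNIV \<and> (\<forall>z\<in>K. dist (g z) (f z) < e)} \<subseteq> U"
      using U f unfolding open_entire_def by blast
    have fh: "f holomorphic_on UNIV" using U f by (auto simp: open_entire_def)
    obtain R where "K \<subseteq> ball 0 R" using compact_imp_bounded[OF K(1)] bounded_subset_ballD by blast
    moreover obtain n where "R \<le> real n" using real_arch_simple by blast
    ultimately have n: "K \<subseteq> ball 0 (real n)" by auto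
    \<comment> \<open>Both f and any g in the neighbourhood lie within e / 2 of the polynomial,
      hence within e of each other on K.\<close>
    obtain k where k: "1 / real (Suc k) < e / 2" using nat_approx_posE[of "e / 2"] K(2) by auto
    obtain cs where cs: "cs \<in> lists D" "\<And>z. z \<in> ball 0 (real n) \<Longrightarrow> dist (f z) (p cs z) \<le> 1 / real (Suc k)"
      unfolding p_def using entire_polynomial_approx[OF fh _ D(2), of "1 / real (Suc k)" "real n"] by auto
    have "Bs (cs, n, k) \<subseteq> U"
    proof
      fix g assume g: "g \<in> Bs (cs, n, k)"
      have "dist (g z) (f z) < e" if "z \<in> K" for z
      proof -
        have "z \<in> ball 0 (real n)" using that n by auto
        then have "dist (g z) (p cs z) \<le> 1 / real (Suc k)" "dist (f z) (p cs z) \<le> 1 / real (Suc k)"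
          using g cs by (auto simp: Bs_def)
        then show ?thesis using k dist_triangle2[of "g z" "f z" "p cs z"] by linarith
      qed
      then show "g \<in> U" using K(3) g by (auto simp: Bs_def)
    qed
    then have "(cs, n, k) \<in> I" using cs by (simp add: I_def)
    moreover have "f \<in> Bs (cs, n, k)" using cs fh by (simp add: Bs_def)
    ultimately show "f \<in> (\<Union>x\<in>I. Bs x)" by blast
  qed (auto simp: I_def)
  finally show ?thesis .
qed

lemma measurable_eval_entire_borel [measurable]: "(\<lambda>f. f z) \<in> borel_measurable entire_borel"
proof (rule borel_measurableI)
  fix S :: "complex set" assume S: "open S"
  have "open_entire {f \<in> entire. f z \<in> S}"
    unfolding open_entire_def
  proof (intro conjI ballI)
    fix f assume "f \<in> {f \<in> entire. f z \<in> S}"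
    then obtain e where "e > 0" "\<And>y. dist y (f z) < e \<Longrightarrow> y \<in> S" using S unfolding open_dist by blast
    then show "\<exists>K e. compact K \<and> e > 0 \<and> {g. g holomorphic_on UNIV \<and> (\<forall>w\<in>K. dist (g w) (f w) < e)} \<subseteq> {f \<in> entire. f z \<in> S}"
      by (intro exI[of _ "{z}"] exI[of _ e]) auto
  qed auto
  moreover have "(\<lambda>f. f z) -` S \<inter> space entire_borel = {f \<in> entire. f z \<in> S}" by auto
  ultimately show "(\<lambda>f. f z) -` S \<inter> space entire_borel \<in> sets entire_borel"
    unfolding sets_entire_borel_open by (auto intro: sigma_sets.Basic)
qed

lemma sets_entire_borel: "sets entire_borel = sigma_sets entire entire_cylinders"
proof
  show "sets entire_borel \<subseteq> sigma_sets entire entire_cylinders"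
    unfolding sets_entire_borel_open
    using open_entire_in_cylinders entire_cylinders_subset
    by (intro sigma_sets_mono) (auto simp: sets_measure_of)
  have m: "coord i \<in> borel_measurable entire_borel" for i
    unfolding coord_def[abs_def] by (cases "snd i") simp_all
  have "A \<in> sets entire_borel" if A': "A \<in> entire_cylinders" for A
  proof -
    obtain F B where A: "A = {f \<in> space entire_borel. \<forall>i\<in>F. coord i f \<in> B i}" "finite F" "\<And>i. B i \<in> sets borel"
      using A' unfolding entire_cylinders_def space_entire_borel by blast
    show ?thesis
      unfolding A(1)
    proof (rule sets.sets_Collect_finite_All[OF _ A(2)])
      show "{f \<in> space entire_borel. coord i f \<in> B i} \<in> sets entire_borel" for i
        using measurable_sets[OF m A(3), of i i] by (simp only: vimage_def Int_def mem_Collect_eq conj_commute)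
    qed
  qed
  then show "sigma_sets entire entire_cylinders \<subseteq> sets entire_borel"
    using sets.sigma_sets_subset[of entire_cylinders entire_borel] by auto
qed

lemma measurable_entire_borelI:
  assumes X: "\<And>\<omega>. \<omega> \<in> space M \<Longrightarrow> X \<omega> holomorphic_on UNIV"
    and [measurable]: "\<And>z. (\<lambda>\<omega>. X \<omega> z) \<in> borel_measurable M"
  shows "X \<in> measurable M entire_borel"
proof (rule measurable_sigma_sets[OF sets_entire_borel entire_cylinders_subset])
  show "X \<in> space M \<rightarrow> entire" using X by auto
  fix A assume "A \<in> entire_cylinders"
  then obtain F B where A: "A = {f \<in> entire. \<forall>i\<in>F. coord i f \<in> B i}" "finite F" "\<And>i. B i \<in> sets borel"
    unfolding entire_cylinders_def by blast
  have m: "(\<lambda>\<omega>. coord i (X \<omega>)) \<in> borel_measurable M" for i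
    unfolding coord_def by (cases "snd i") simp_all
  have "X -` A \<inter> space M = {\<omega> \<in> space M. \<forall>i\<in>F. coord i (X \<omega>) \<in> B i}"
    using X by (auto simp: A)
  also have "\<dots> \<in> sets M"
  proof (rule sets.sets_Collect_finite_All[OF _ A(2)])
    show "{\<omega> \<in> space M. coord i (X \<omega>) \<in> B i} \<in> sets M" for i
      using measurable_sets[OF m A(3), of i i] by (simp only: vimage_def Int_def mem_Collect_eq conj_commute)
  qed
  finally show "X -` A \<inter> space M \<in> sets M" .
qed

lemma (in prob_space) entire_law_eqI:
  assumes X: "X \<in> measurable M entire_borel" and Y: "Y \<in> measurable M entire_borel"
    and eq: "\<And>J t. finite J \<Longrightarrow> (CLINT \<omega>|M. iexp (\<Sum>i\<in>J. t i * coord i (X \<omega>))) = (CLINT \<omega>|M. iexp (\<Sum>i\<in>J. t i * coord i (Y \<omega>)))"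
  shows "distr M entire_borel X = distr M entire_borel Y"
proof (rule measure_eqI_generator_eq[of entire_cylinders entire])
  show "Int_stable entire_cylinders"
  proof (rule Int_stableI)
    fix a b assume "a \<in> entire_cylinders" "b \<in> entire_cylinders"
    then obtain F B G C where
      a: "a = {f \<in> entire. \<forall>i\<in>F. coord i f \<in> B i}" "finite F" "\<And>i. B i \<in> sets borel" and
      b: "b = {f \<in> entire. \<forall>i\<in>G. coord i f \<in> C i}" "finite G" "\<And>i. C i \<in> sets borel"
      unfolding entire_cylinders_def by blast
    \<comment> \<open>Padding by \<open>UNIV\<close> lets one family of Borel sets describe both
      cylinders over the union of their index sets.\<close>
    define E where "E i = (if i \<in> F then B i else UNIV) \<inter> (if i \<in> G then C i else UNIV)" for i
    have "a \<inter> b = {f \<in> entire. \<forall>i\<in>F \<union> G. coord i f \<in> E i}"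
      unfolding a(1) b(1) E_def by auto
    also have "\<dots> \<in> entire_cylinders"
      using a b by (intro entire_cylindersI) (auto simp: E_def)
    finally show "a \<inter> b \<in> entire_cylinders" .
  qed
  show "entire_cylinders \<subseteq> Pow entire" by (rule entire_cylinders_subset)
  have m: "coord i \<in> borel_measurable entire_borel" for i
    unfolding coord_def[abs_def] by (cases "snd i") simp_all
  show "emeasure (distr M entire_borel X) A = emeasure (distr M entire_borel Y) A" if A': "A \<in> entire_cylinders" for A
  proof -
    obtain F B where A: "A = {f \<in> entire. \<forall>i\<in>F. coord i f \<in> B i}" "finite F" "\<And>i. B i \<in> sets borel"
      using A' unfolding entire_cylinders_def by blast
    have As: "A \<in> sets entire_borel" using A' by (auto simp: sets_entire_borel)
    have "emeasure (distr M entire_borel Z) A = emeasure M {\<omega>\<in>space M. \<forall>i\<in>F. coord i (Z \<omega>) \<in> B i}"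
      if Z: "Z \<in> measurable M entire_borel" for Z
      using measurable_space[OF Z] by (subst emeasure_distr[OF Z As]) (auto intro!: arg_cong[where f = "emeasure M"] simp: A)
    then show ?thesis
      using char_determines_fdd[of "\<lambda>i \<omega>. coord i (X \<omega>)" "\<lambda>i \<omega>. coord i (Y \<omega>)" F B] X Y eq A
      by (simp add: measurable_compose[OF X m] measurable_compose[OF Y m])
  qed
  have "entire \<in> entire_cylinders"
    using entire_cylindersI[of "{}" "\<lambda>_. UNIV"] by simp
  then show "range (\<lambda>_::nat. entire) \<subseteq> entire_cylinders" by auto
  show "emeasure (distr M entire_borel X) entire \<noteq> \<infinity>"
  proof -
    interpret D: prob_space "distr M entire_borel X" by (rule prob_space_distr[OF X])
    show ?thesis by simp
  qed
qed (auto simp: sets_entire_borel)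

section \<open>Measurability and scaling of the zero process\<close>

text \<open>A witness \<open>w\<close> with F w \<noteq> 0 is how "not the zero function" is
  expressed throughout; it covers nonzero constants as well.\<close>

lemma entire_finite_zeros:
  assumes "F holomorphic_on UNIV" "F w \<noteq> 0" "bounded B"
  shows "finite {z\<in>B. F z = 0}"
proof (cases "F constant_on UNIV")
  case True
  then have "F z \<noteq> 0" for z using assms(2) unfolding constant_on_def by (metis UNIV_I)
  then show ?thesis by simp
next
  case False
  have "finite {z\<in>closure B. F z = 0}"
    using holomorphic_compact_finite_zeros[OF assms(1) open_UNIV connected_UNIV _ _ False, of "closure B"] assms(3)
    by (simp add: compact_closure)
  then show ?thesis by (rule rev_finite_subset) (use closure_subset in auto)
qed

lemma entire_eventually_nonzero:
  assumes "F holomorphic_on UNIV" "F w \<noteq> 0"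
  shows "\<forall>\<^sub>F z in at z. F z \<noteq> 0"
  using non_zero_neighbour_alt[OF assms(1) open_UNIV connected_UNIV UNIV_I, of w z] assms(2) by simp

text \<open>Ensures that the conversion \<open>nat\<close> in \<open>zero_process\<close> loses
  nothing.\<close>

lemma entire_zorder_ge_0:
  assumes "F holomorphic_on UNIV" "F w \<noteq> 0"
  shows "zorder F z \<ge> 0"
  using assms entire_eventually_nonzero[OF assms, of z]
  by (intro zorder_ge_0) (auto simp: analytic_at_two analytic_on_open intro!: eventually_frequently holomorphic_on_imp_analytic_at[of _ UNIV])

lemma sets_zero_process [simp, measurable_cong]: "sets (zero_process F) = sets borel"
  by (simp add: zero_process_def)

lemma emeasure_zero_process:
  assumes "F holomorphic_on UNIV" "F w \<noteq> 0" "bounded B" "B \<in> sets borel"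
  shows "emeasure (zero_process F) B = (\<Sum>z | z \<in> B \<and> F z = 0. of_nat (nat (zorder F z)))"
proof -
  have "emeasure (zero_process F) B = emeasure (point_measure {z. F z = 0} (\<lambda>z. of_nat (nat (zorder F z)))) {z. z \<in> B \<and> F z = 0}"
    unfolding zero_process_def using assms(4)
    by (subst emeasure_distr) (auto simp: point_measure_def intro!: arg_cong2[where f = emeasure])
  also have "\<dots> = (\<Sum>z | z \<in> B \<and> F z = 0. of_nat (nat (zorder F z)))"
    using entire_finite_zeros[OF assms(1-3)] by (subst emeasure_point_measure_finite2) auto
  finally show ?thesis .
qed

text \<open>Rouche's theorem weights zeros by winding numbers, which for the circle are 1 inside and
  0 outside. The strict inequality excludes zeros on the circle itself; the larger ball of radius r
  + 1 is merely the open domain that the theorem works in.\<close>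

lemma Rouche_ball:
  assumes F: "F holomorphic_on UNIV" and g: "g holomorphic_on UNIV" and r: "r > 0"
    and less: "\<And>w. w \<in> sphere z r \<Longrightarrow> dist (g w) (F w) < norm (F w)"
  shows "emeasure (zero_process g) (ball z r) = emeasure (zero_process F) (ball z r)"
proof -
  obtain w where w: "w \<in> sphere z r" using r by (metis ex_in_conv less_eq_real_def sphere_eq_empty not_le)
  have Fw: "F w \<noteq> 0" using less[OF w] by auto
  have gw: "g w \<noteq> 0" using less[OF w] by (auto simp: dist_norm)
  have fin: "finite {p \<in> ball z (r + 1). F p = 0}" "finite {p \<in> ball z (r + 1). g p = 0}"
    by (rule entire_finite_zeros[OF F Fw bounded_ball] entire_finite_zeros[OF g gw bounded_ball])+
  have wn_out: "winding_number (circlepath z r) p = 0" if "p \<notin> cball z r" for p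
    by (rule winding_number_zero_outside[OF _ convex_cball _ that])
      (use r in \<open>auto simp: path_image_circlepath_nonneg\<close>)
  have "(\<Sum>p | p \<in> ball z (r + 1) \<and> F p + (g p - F p) = 0. winding_number (circlepath z r) p * of_int (zorder (\<lambda>p. F p + (g p - F p)) p))
      = (\<Sum>p | p \<in> ball z (r + 1) \<and> F p = 0. winding_number (circlepath z r) p * of_int (zorder F p))"
  proof (rule Rouche_theorem)
    show "\<forall>p\<in>path_image (circlepath z r). cmod (g p - F p) < cmod (F p)"
      using less r by (auto simp: path_image_circlepath_nonneg dist_norm)
    show "\<forall>p. p \<notin> ball z (r + 1) \<longrightarrow> winding_number (circlepath z r) p = 0"
      using wn_out by auto
  qed (use fin r F g in \<open>auto intro!: holomorphic_intros intro: holomorphic_on_subset simp: path_image_circlepath_nonneg\<close>)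
  then have eq: "(\<Sum>p | p \<in> ball z (r + 1) \<and> g p = 0. winding_number (circlepath z r) p * of_int (zorder g p))
      = (\<Sum>p | p \<in> ball z (r + 1) \<and> F p = 0. winding_number (circlepath z r) p * of_int (zorder F p))"
    by simp
  have *: "(\<Sum>p | p \<in> ball z (r + 1) \<and> h p = 0. winding_number (circlepath z r) p * of_int (zorder h p))
      = of_nat (\<Sum>p | p \<in> ball z r \<and> h p = 0. nat (zorder h p))"
    if h: "h holomorphic_on UNIV" "h w \<noteq> 0" and ns: "\<And>p. p \<in> sphere z r \<Longrightarrow> h p \<noteq> 0" for h
  proof -
    have "(\<Sum>p | p \<in> ball z (r + 1) \<and> h p = 0. winding_number (circlepath z r) p * of_int (zorder h p))
        = (\<Sum>p | p \<in> ball z r \<and> h p = 0. winding_number (circlepath z r) p * of_int (zorder h p))"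
    proof (rule sum.mono_neutral_right)
      show "finite {p. p \<in> ball z (r + 1) \<and> h p = 0}" using entire_finite_zeros[OF h bounded_ball] by simp
      show "\<forall>p\<in>{p. p \<in> ball z (r + 1) \<and> h p = 0} - {p. p \<in> ball z r \<and> h p = 0}. winding_number (circlepath z r) p * of_int (zorder h p) = 0"
      proof
        fix p assume p: "p \<in> {p. p \<in> ball z (r + 1) \<and> h p = 0} - {p. p \<in> ball z r \<and> h p = 0}"
        then have "p \<notin> cball z r" using ns[of p] by auto
        then show "winding_number (circlepath z r) p * of_int (zorder h p) = 0" using wn_out by simp
      qed
    qed auto
    also have "\<dots> = (\<Sum>p | p \<in> ball z r \<and> h p = 0. of_nat (nat (zorder h p)))"
    proof (rule sum.cong[OF refl])
      fix p assume "p \<in> {p. p \<in> ball z r \<and> h p = 0}"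
      then have "winding_number (circlepath z r) p = 1"
        by (intro winding_number_circlepath) (simp add: dist_norm norm_minus_commute)
      then show "winding_number (circlepath z r) p * of_int (zorder h p) = of_nat (nat (zorder h p))"
        using entire_zorder_ge_0[OF h, of p] by simp
    qed
    finally show ?thesis by simp
  qed
  have "F p \<noteq> 0" "g p \<noteq> 0" if "p \<in> sphere z r" for p using less[OF that] by (auto simp: dist_norm)
  then have "(of_nat (\<Sum>p | p \<in> ball z r \<and> g p = 0. nat (zorder g p)) :: complex) = of_nat (\<Sum>p | p \<in> ball z r \<and> F p = 0. nat (zorder F p))"
    using eq *[OF g gw] *[OF F Fw] by simp
  then have "(\<Sum>p | p \<in> ball z r \<and> g p = 0. nat (zorder g p)) = (\<Sum>p | p \<in> ball z r \<and> F p = 0. nat (zorder F p))"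
    by (simp only: of_nat_eq_iff)
  then show ?thesis
    using emeasure_zero_process[OF F Fw bounded_ball, of z r] emeasure_zero_process[OF g gw bounded_ball, of z r]
    by (simp flip: of_nat_sum)
qed

text \<open>Small disjoint discs around the zeros of F in U keep their numbers of zeros under a
  perturbation that is small on the circles. The perturbed function may have further zeros in U, so
  the count can only be bounded from below.\<close>

lemma open_entire_zero_count:
  assumes U: "open U" "bounded U"
  shows "open_entire {F \<in> entire. F \<noteq> (\<lambda>_. 0) \<and> a < emeasure (zero_process F) U}"
  unfolding open_entire_def
proof (intro conjI ballI)
  fix F assume "F \<in> {F \<in> entire. F \<noteq> (\<lambda>_. 0) \<and> a < emeasure (zero_process F) U}"
  then have F: "F holomorphic_on UNIV" "F \<noteq> (\<lambda>_. 0)" and a: "a < emeasure (zero_process F) U" by auto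
  from F(2) obtain w where w: "F w \<noteq> 0" by auto
  define S where "S = {z. z \<in> U \<and> F z = 0}"
  have S: "finite S" using entire_finite_zeros[OF F(1) w U(2)] by (simp add: S_def)
  have ems: "emeasure (zero_process F) U = (\<Sum>z\<in>S. of_nat (nat (zorder F z)))"
    unfolding S_def using U by (intro emeasure_zero_process[OF F(1) w]) auto
  with a have "S \<noteq> {}" by auto
  \<comment> \<open>The factor 3 leaves room both for disjoint balls and for circles that carry no
    zero of F.\<close>
  have "\<exists>r>0. cball z r \<subseteq> U \<and> (\<forall>y\<in>S. y \<noteq> z \<longrightarrow> 3 * r \<le> dist z y)" if zS: "z \<in> S" for z
  proof -
    obtain r1 where r1: "r1 > 0" "cball z r1 \<subseteq> U" using U(1) zS unfolding open_contains_cball S_def by blast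
    obtain d where d: "d > 0" "\<forall>y\<in>S. y \<noteq> z \<longrightarrow> d \<le> dist z y" using finite_set_avoid[OF S] by blast
    have "cball z (min r1 (d / 3)) \<subseteq> U" using r1(2) by auto
    moreover have "3 * min r1 (d / 3) \<le> dist z y" if "y \<in> S" "y \<noteq> z" for y
      using d(2) that by fastforce
    ultimately show ?thesis using r1(1) d(1) by (intro exI[of _ "min r1 (d / 3)"]) auto
  qed
  then obtain r where r: "\<And>z. z \<in> S \<Longrightarrow> r z > 0" "\<And>z. z \<in> S \<Longrightarrow> cball z (r z) \<subseteq> U"
      "\<And>z y. z \<in> S \<Longrightarrow> y \<in> S \<Longrightarrow> y \<noteq> z \<Longrightarrow> 3 * r z \<le> dist z y"
    by metis
  have disj: "disjoint_family_on (\<lambda>z. ball z (r z)) S"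
    unfolding disjoint_family_on_def
  proof (intro ballI impI)
    fix y z assume yz: "y \<in> S" "z \<in> S" "y \<noteq> z"
    show "ball y (r y) \<inter> ball z (r z) = {}"
    proof (rule disjoint_ballI)
      show "r y + r z \<le> dist y z"
        using r(1)[OF yz(1)] r(1)[OF yz(2)] r(3)[OF yz(1,2)] r(3)[OF yz(2,1)] yz(3) by (auto simp: dist_commute)
    qed
  qed
  define K where "K = (\<Union>z\<in>S. sphere z (r z))"
  have K: "compact K" unfolding K_def using S by (intro compact_UN) auto
  have "K \<noteq> {}" using \<open>S \<noteq> {}\<close> r(1) by (fastforce simp: K_def sphere_eq_empty less_eq_real_def)
  have K0: "F p \<noteq> 0" if "p \<in> K" for p
  proof
    assume p0: "F p = 0"
    from that obtain z where z: "z \<in> S" "dist z p = r z" by (auto simp: K_def)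
    then have "p \<in> S" using r(2)[OF z(1)] p0 by (auto simp: S_def)
    moreover have "p \<noteq> z" using z r(1)[OF z(1)] by auto
    ultimately show False using r(3)[OF z(1), of p] r(1)[OF z(1)] z(2) by auto
  qed
  have "continuous_on K (\<lambda>p. norm (F p))"
    using F(1) by (intro continuous_intros holomorphic_on_imp_continuous_on) (auto intro: holomorphic_on_subset)
  \<comment> \<open>The minimum of |F| on the circles is positive and serves as the admissible
    perturbation in Rouche's theorem.\<close>
  then obtain p0 where p0: "p0 \<in> K" "\<And>p. p \<in> K \<Longrightarrow> norm (F p0) \<le> norm (F p)"
    using continuous_attains_inf[OF K \<open>K \<noteq> {}\<close>] by blast
  have "{g. g holomorphic_on UNIV \<and> (\<forall>p\<in>K. dist (g p) (F p) < norm (F p0))} \<subseteq> {F \<in> entire. F \<noteq> (\<lambda>_. 0) \<and> a < emeasure (zero_process F) U}"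
  proof
    fix g assume "g \<in> {g. g holomorphic_on UNIV \<and> (\<forall>p\<in>K. dist (g p) (F p) < norm (F p0))}"
    then have g: "g holomorphic_on UNIV" and gF: "\<And>p. p \<in> K \<Longrightarrow> dist (g p) (F p) < norm (F p)"
      using p0 by (auto intro: less_le_trans)
    have "g p0 \<noteq> 0" using gF[OF p0(1)] by (auto simp: dist_norm)
    have "a < (\<Sum>z\<in>S. emeasure (zero_process F) (ball z (r z)))"
    proof -
      have "of_nat (nat (zorder F z)) \<le> emeasure (zero_process F) (ball z (r z))" if "z \<in> S" for z
        unfolding emeasure_zero_process[OF F(1) w bounded_ball borel_open[OF open_ball]]
        using entire_finite_zeros[OF F(1) w bounded_ball, of z "r z"] r(1)[OF that] that
        by (intro member_le_sum[where f = "\<lambda>p. of_nat (nat (zorder F p)) :: ennreal"]) (auto simp: S_def)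
      then show ?thesis using a unfolding ems by (meson less_le_trans sum_mono)
    qed
    also have "\<dots> = (\<Sum>z\<in>S. emeasure (zero_process g) (ball z (r z)))"
      by (intro sum.cong refl Rouche_ball[symmetric] F g r(1) gF) (auto simp: K_def)
    also have "\<dots> = emeasure (zero_process g) (\<Union>z\<in>S. ball z (r z))"
      using S disj by (intro sum_emeasure) auto
    also have "\<dots> \<le> emeasure (zero_process g) U"
      using r(2) U by (intro emeasure_mono) (auto simp: subset_iff)
    finally show "g \<in> {F \<in> entire. F \<noteq> (\<lambda>_. 0) \<and> a < emeasure (zero_process F) U}"
      using g \<open>g p0 \<noteq> 0\<close> by auto
  qed
  then show "\<exists>K e. compact K \<and> e > 0 \<and> {g. g holomorphic_on UNIV \<and> (\<forall>z\<in>K. dist (g z) (F z) < e)} \<subseteq> {F \<in> entire. F \<noteq> (\<lambda>_. 0) \<and> a < emeasure (zero_process F) U}"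
    using K K0[OF p0(1)] by (intro exI[of _ K] exI[of _ "norm (F p0)"]) simp
qed auto

text \<open>\<^const>\<open>zero_process\<close> made total: the zero function, whose zeros are not isolated, is sent to the
  empty configuration.\<close>

definition zero_process' :: "(complex \<Rightarrow> complex) \<Rightarrow> complex measure" where
  "zero_process' F = zero_process (if F = (\<lambda>_. 0) then (\<lambda>_. 1) else F)"

lemma sets_zero_process' [simp, measurable_cong]: "sets (zero_process' F) = sets borel"
  by (simp add: zero_process'_def)

section \<open>Measurability of the counting maps\<close>

lemma zero_process'_bounded:
  assumes "F \<in> entire" "bounded B" "B \<in> sets borel"
  shows "\<exists>n::nat. emeasure (zero_process' F) B = of_nat n"
proof -
  define G where "G = (if F = (\<lambda>_. 0) then (\<lambda>_. 1) else F)"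
  have "G holomorphic_on UNIV" using assms by (auto simp: G_def)
  moreover have "\<exists>w. G w \<noteq> 0" by (auto simp: G_def)
  then obtain w where "G w \<noteq> 0" ..
  ultimately show ?thesis
    unfolding zero_process'_def G_def[symmetric] using emeasure_zero_process[of G w B] assms
    by (intro exI[of _ "\<Sum>z | z \<in> B \<and> G z = 0. nat (zorder G z)"]) simp
qed

text \<open>An induction from open sets over complements and disjoint unions. The intersection with
  a ball keeps all counts finite, so complements become differences; a monotone limit over growing
  balls removes it afterwards.\<close>

lemma measurable_zero_count_bounded:
  assumes "B \<in> sets borel"
  shows "(\<lambda>F. emeasure (zero_process' F) (B \<inter> ball 0 R)) \<in> borel_measurable entire_borel"
proof -
  have fin: "emeasure (zero_process' F) (B \<inter> ball 0 R) \<noteq> \<infinity>" if "F \<in> entire" "B \<in> sets borel" for F B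
    using zero_process'_bounded[OF that(1) bounded_subset[OF bounded_ball Int_lower2], of B 0 R] that by auto
  have op: "(\<lambda>F. emeasure (zero_process' F) U) \<in> borel_measurable entire_borel" if U: "open U" "bounded U" for U
  proof (rule borel_measurableI_greater)
    fix a :: ennreal
    \<comment> \<open>The zero-free substitute for the zero function has count 0, so it never
      exceeds \<open>a\<close> and stays outside the open set.\<close>
    have "emeasure (zero_process (\<lambda>_. 1)) U = 0"
      using emeasure_zero_process[of "\<lambda>_. 1" 0 U] U by simp
    then have "{F \<in> space entire_borel. a < emeasure (zero_process' F) U} = {F \<in> entire. F \<noteq> (\<lambda>_. 0) \<and> a < emeasure (zero_process F) U}"
      by (auto simp: zero_process'_def split: if_splits)
    then show "{F \<in> space entire_borel. a < emeasure (zero_process' F) U} \<in> sets entire_borel"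
      using open_entire_zero_count[OF U, of a] by (auto simp: sets_entire_borel_open intro: sigma_sets.Basic)
  qed
  have "Int_stable {S :: complex set. open S}" "{S :: complex set. open S} \<subseteq> Pow UNIV"
      "B \<in> sigma_sets UNIV {S :: complex set. open S}"
    using assms by (auto simp: borel_def Int_stable_def)
  then show ?thesis
  proof (induction rule: sigma_sets_induct_disjoint)
    case (basic A)
    then show ?case by (intro op) auto
  next
    case empty
    then show ?case by simp
  next
    case (compl A)
    have A: "A \<in> sets borel" using compl by (simp add: borel_def)
    have eq: "emeasure (zero_process' F) ((UNIV - A) \<inter> ball 0 R) = emeasure (zero_process' F) (ball 0 R) - emeasure (zero_process' F) (A \<inter> ball 0 R)"
      if "F \<in> space entire_borel" for F
    proof -
      have "(UNIV - A) \<inter> ball 0 R = ball 0 R - A \<inter> ball 0 R" by auto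
      then show ?thesis
        using fin[of F A] that A by (simp add: emeasure_Diff)
    qed
    have ms: "(\<lambda>F. emeasure (zero_process' F) (ball 0 R) - emeasure (zero_process' F) (A \<inter> ball 0 R)) \<in> borel_measurable entire_borel"
      using compl.IH op[of "ball 0 R"] by simp
    show ?case
      by (rule measurable_cong[THEN iffD2, OF _ ms]) (rule eq)
  next
    case (union A)
    have A: "A i \<in> sets borel" for i using union.hyps by (auto simp: borel_def)
    have "emeasure (zero_process' F) (\<Union> (range A) \<inter> ball 0 R) = (\<Sum>i. emeasure (zero_process' F) (A i \<inter> ball 0 R))" for F
    proof -
      have "\<Union> (range A) \<inter> ball 0 R = (\<Union>i. A i \<inter> ball 0 R)" by auto
      moreover have "disjoint_family (\<lambda>i. A i \<inter> ball 0 R)"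
        using union.hyps(1) unfolding disjoint_family_on_def by blast
      ultimately show ?thesis
        using A by (subst suminf_emeasure) auto
    qed
    then show ?case using union.IH by simp
  qed
qed

lemma measurable_zero_process':
  "zero_process' \<in> measurable entire_borel point_configurations"
proof -
  let ?C = "{\<mu> :: complex measure. sets \<mu> = sets borel \<and> (\<forall>A\<in>sets borel. bounded A \<longrightarrow> (\<exists>n::nat. emeasure \<mu> A = of_nat n))}"
  have "(\<lambda>F. emeasure (zero_process' F) B) \<in> borel_measurable entire_borel" if B: "B \<in> sets borel" for B
  proof -
    have "emeasure (zero_process' F) B = (SUP n. emeasure (zero_process' F) (B \<inter> ball 0 (real n)))" for F
    proof -
      have "(SUP n. emeasure (zero_process' F) (B \<inter> ball 0 (real n))) = emeasure (zero_process' F) (\<Union>n. B \<inter> ball 0 (real n))"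
        using B by (intro SUP_emeasure_incseq) (auto simp: incseq_def)
      also have "(\<Union>n. B \<inter> ball 0 (real n)) = B"
        using reals_Archimedean2 by (auto simp: mem_ball_0)
      finally show ?thesis by simp
    qed
    then show ?thesis
      using measurable_zero_count_bounded[OF B] by simp
  qed
  then show ?thesis
    unfolding point_configurations_def
    using zero_process'_bounded
    by (intro measurable_SUP2 measurable_vimage_algebra2) (auto simp: space_vimage_algebra)
qed

text \<open>The zero-free factor \<open>h\<close> changes neither the zeros nor their orders, and
  multiplication by \<open>s\<close> maps the zeros of the product bijectively and with equal orders
  onto those of \<open>H\<close>.\<close>

lemma scale_zero_process:
  assumes H: "H holomorphic_on UNIV" "H w \<noteq> 0" and h: "h holomorphic_on UNIV" "\<And>z. h z \<noteq> 0" and s: "s \<noteq> 0"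
  shows "scale_process (1 / s) (zero_process H) = zero_process (\<lambda>z. h z * H (z * s))"
proof -
  let ?V = "\<lambda>z. h z * H (z * s)"
  have z: "zorder ?V z = zorder H (z * s)" for z
  proof -
    have Ha: "H analytic_on {s * z}" using H(1) by (auto intro: holomorphic_on_imp_analytic_at)
    have ha: "h analytic_on {z}" using h(1) by (auto intro: holomorphic_on_imp_analytic_at)
    have Hs: "(\<lambda>z. H (s * z)) holomorphic_on UNIV"
      using holomorphic_on_compose[of "\<lambda>z. s * z" UNIV H] H(1)
      by (auto simp: o_def intro!: holomorphic_intros intro: holomorphic_on_subset)
    have "zorder (\<lambda>z. h z * H (s * z)) z = zorder h z + zorder (\<lambda>z. H (s * z)) z"
    proof (rule zorder_times_analytic[OF ha])
      show "(\<lambda>z. H (s * z)) analytic_on {z}" using Hs by (auto intro: holomorphic_on_imp_analytic_at)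
      show "\<forall>\<^sub>F z in at z. h z * H (s * z) \<noteq> 0"
        using entire_eventually_nonzero[OF Hs, of "w / s" z] H(2) h(2) s by simp
    qed
    also have "zorder h z = 0" using zorder_eq_0I[OF ha] h(2) by simp
    also have "zorder (\<lambda>z. H (s * z)) z = zorder H (s * z)"
      by (intro zorder_scale s analytic_on_imp_meromorphic_on Ha)
    finally show ?thesis by (simp add: mult.commute)
  qed
  show ?thesis
  proof (rule measure_eqI)
    fix B assume "B \<in> sets (scale_process (1 / s) (zero_process H))"
    then have B: "B \<in> sets borel" by (simp add: scale_process_def)
    \<comment> \<open>Equality of measures concerns unbounded sets too, which may contain infinitely
      many zeros; an integral over a counting measure replaces the finite sum.\<close>
    have e: "emeasure (zero_process F) A = (\<integral>\<^sup>+z. of_nat (nat (zorder F z)) * indicator A z \<partial>count_space {z. F z = 0})"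
      if "A \<in> sets borel" for F A
    proof -
      have "emeasure (zero_process F) A = emeasure (point_measure {z. F z = 0} (\<lambda>z. of_nat (nat (zorder F z)))) (A \<inter> {z. F z = 0})"
        unfolding zero_process_def using that by (subst emeasure_distr) (auto simp: point_measure_def)
      also have "\<dots> = (\<integral>\<^sup>+z. of_nat (nat (zorder F z)) * indicator A z \<partial>count_space {z. F z = 0})"
        unfolding point_measure_def by (subst emeasure_density) (auto intro!: nn_integral_cong simp: indicator_def)
      finally show ?thesis .
    qed
    let ?A = "(\<lambda>z. z / s) -` B"
    have A: "?A \<in> sets borel"
    proof -
      have "(\<lambda>z. z / s) \<in> borel_measurable borel" by simp
      from measurable_sets[OF this B] show ?thesis by simp
    qed
    have m: "(\<lambda>z. 1 / s * z) \<in> zero_process H \<rightarrow>\<^sub>M borel"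
      by (simp only: measurable_cong_sets[OF sets_zero_process refl]) simp
    have "emeasure (scale_process (1 / s) (zero_process H)) B = emeasure (zero_process H) ?A"
      unfolding scale_process_def using B sets_eq_imp_space_eq[OF sets_zero_process[of H]]
      by (subst emeasure_distr[OF m]) (auto intro!: arg_cong2[where f = emeasure])
    also have "\<dots> = (\<integral>\<^sup>+z. of_nat (nat (zorder H z)) * indicator ?A z \<partial>count_space {z. H z = 0})"
      by (rule e[OF A])
    also have "\<dots> = (\<integral>\<^sup>+z. of_nat (nat (zorder H (z * s))) * indicator ?A (z * s) \<partial>count_space {z. ?V z = 0})"
      using s h by (intro nn_integral_bij_count_space[symmetric] bij_betwI[of _ _ _ "\<lambda>z. z / s"]) auto
    also have "\<dots> = (\<integral>\<^sup>+z. of_nat (nat (zorder ?V z)) * indicator B z \<partial>count_space {z. ?V z = 0})"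
      using s by (intro nn_integral_cong) (auto simp: z indicator_def)
    also have "\<dots> = emeasure (zero_process ?V) B" by (rule e[OF B, symmetric])
    finally show "emeasure (scale_process (1 / s) (zero_process H)) B = emeasure (zero_process ?V) B" .
  qed (simp add: scale_process_def)
qed

section \<open>Invariance of the law\<close>

text \<open>Mehler's formula at the points z s and w s, with s^2 = 1 - |\<tau>|^2. The two
  prefactors (1 - |\<tau>|^2)^(1/4) multiply to s and cancel the 1 / s of the formula; the two
  exponentials cancel the terms in z^2 and in (cnj w)^2.\<close>

lemma V_op_basis_kernel:
  fixes \<tau> :: complex
  defines "\<psi> \<equiv> \<lambda>n z. of_real ((1 - (cmod \<tau>)\<^sup>2) powr (1 / 4)) * exp (cnj \<tau> * z\<^sup>2 / 2) *
      (heat_monomial \<tau> n (z * of_real (sqrt (1 - (cmod \<tau>)\<^sup>2))) / of_real (sqrt (fact n)))"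
  assumes \<tau>: "cmod \<tau> < 1"
  shows "(\<lambda>n. \<psi> n z * cnj (\<psi> n w)) sums exp (z * cnj w)"
proof -
  define s where "s = sqrt (1 - (cmod \<tau>)\<^sup>2)"
  define c where "c = (1 - (cmod \<tau>)\<^sup>2) powr (1 / 4)"
  have pos: "1 - (cmod \<tau>)\<^sup>2 > 0" using \<tau> by (simp add: abs_square_less_1)
  then have s: "s > 0" "s\<^sup>2 = 1 - (cmod \<tau>)\<^sup>2" by (simp_all add: s_def)
  have cc: "c * c = s"
    using pos by (simp add: c_def s_def powr_add[symmetric] powr_half_sqrt)
  let ?s = "of_real s :: complex" and ?W = "cnj w"
  have s2: "?s\<^sup>2 = 1 - \<tau> * cnj \<tau>"
    using s(2) by (simp add: complex_norm_square[symmetric] flip: of_real_power)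
  define E where "E = (z * ?s) * cnj (w * ?s) - cnj \<tau> * (z * ?s)\<^sup>2 / 2 - \<tau> * (cnj (w * ?s) - cnj \<tau> * (z * ?s))\<^sup>2 / (2 * of_real (1 - (cmod \<tau>)\<^sup>2))"
  let ?p = "of_real s * (exp (cnj \<tau> * z\<^sup>2 / 2) * exp (\<tau> * ?W\<^sup>2 / 2))"
  have "(\<lambda>n. ?p * (heat_monomial \<tau> n (z * ?s) * cnj (heat_monomial \<tau> n (w * ?s)) / fact n)) sums
      (?p * (of_real (1 / s) * exp E))"
    using sums_mult[OF heat_monomial_Mehler[OF \<tau>, of "z * ?s" "w * ?s"], of ?p]
    by (simp only: E_def s_def[symmetric])
  moreover have "\<psi> n z * cnj (\<psi> n w) = ?p * (heat_monomial \<tau> n (z * ?s) * cnj (heat_monomial \<tau> n (w * ?s)) / fact n)" for n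
  proof -
    have f: "of_real (sqrt (fact n)) * of_real (sqrt (fact n)) = (fact n :: complex)"
      unfolding of_real_mult[symmetric] by simp
    have "\<psi> n z * cnj (\<psi> n w) = of_real (c * c) * (exp (cnj \<tau> * z\<^sup>2 / 2) * exp (\<tau> * ?W\<^sup>2 / 2)) *
       (heat_monomial \<tau> n (z * ?s) * cnj (heat_monomial \<tau> n (w * ?s)) / (of_real (sqrt (fact n)) * of_real (sqrt (fact n))))"
      by (simp add: \<psi>_def s_def[symmetric] c_def[symmetric] exp_cnj mult_ac)
    then show ?thesis unfolding cc f .
  qed
  moreover have "?p * (of_real (1 / s) * exp E) = exp (z * ?W)"
  proof -
    have "\<tau> * (cnj (w * ?s) - cnj \<tau> * (z * ?s))\<^sup>2 / (2 * of_real (1 - (cmod \<tau>)\<^sup>2)) = \<tau> * (?W - cnj \<tau> * z)\<^sup>2 / 2"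
    proof -
      have "cnj (w * ?s) - cnj \<tau> * (z * ?s) = (?W - cnj \<tau> * z) * ?s" by (simp add: algebra_simps)
      moreover have "of_real (1 - (cmod \<tau>)\<^sup>2) = ?s\<^sup>2" using s(2) by (metis of_real_power)
      ultimately show ?thesis using s(1) by (simp only: power_mult_distrib) simp
    qed
    then have "E = z * ?W * ?s\<^sup>2 - cnj \<tau> * z\<^sup>2 * ?s\<^sup>2 / 2 - \<tau> * (?W - cnj \<tau> * z)\<^sup>2 / 2"
      unfolding E_def by (simp add: power_mult_distrib power2_eq_square mult_ac)
    \<comment> \<open>The terms in (cnj w)^2 cancel at once; s^2 = 1 - \<tau> cnj \<tau> removes
      those in z^2 and makes the coefficient of z cnj w equal to 1.\<close>
    then have "cnj \<tau> * z\<^sup>2 / 2 + \<tau> * ?W\<^sup>2 / 2 + E = z * ?W"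
      unfolding s2 by (simp add: power2_eq_square algebra_simps diff_divide_distrib add_divide_distrib)
    moreover have "?p * (of_real (1 / s) * exp E) = exp (cnj \<tau> * z\<^sup>2 / 2 + \<tau> * ?W\<^sup>2 / 2 + E)"
      using s(1) by (simp add: exp_add)
    ultimately show ?thesis by simp
  qed
  ultimately show ?thesis by simp
qed

lemma gaf_basis_kernel:
  "(\<lambda>n. (z ^ n / of_real (sqrt (fact n))) * cnj (w ^ n / of_real (sqrt (fact n)))) sums exp (z * cnj w)"
proof -
  have f: "of_real (sqrt (fact n)) * of_real (sqrt (fact n)) = (fact n :: complex)" for n
    unfolding of_real_mult[symmetric] by simp
  have "(z ^ n / of_real (sqrt (fact n))) * cnj (w ^ n / of_real (sqrt (fact n))) = (z * cnj w) ^ n /\<^sub>R fact n" for n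
  proof -
    have "(z ^ n / of_real (sqrt (fact n))) * cnj (w ^ n / of_real (sqrt (fact n))) = (z * cnj w) ^ n / (of_real (sqrt (fact n)) * of_real (sqrt (fact n)))"
      by (simp add: power_mult_distrib)
    also have "\<dots> = (z * cnj w) ^ n /\<^sub>R fact n" unfolding f by (simp add: scaleR_conv_of_real field_simps)
    finally show ?thesis .
  qed
  then show ?thesis using exp_converges[of "z * cnj w"] by simp
qed

lemma V_op_gaf:
  assumes x: "linear_growth (\<lambda>n. \<xi> n \<omega>)" and \<tau>: "norm \<tau> < 1"
  shows "(\<lambda>n. \<xi> n \<omega> * (of_real ((1 - (cmod \<tau>)\<^sup>2) powr (1 / 4)) * exp (cnj \<tau> * z\<^sup>2 / 2) *
      (heat_monomial \<tau> n (z * of_real (sqrt (1 - (cmod \<tau>)\<^sup>2))) / of_real (sqrt (fact n))))) sums V_op \<tau> (gaf \<xi> \<omega>) z"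
    and "V_op \<tau> (gaf \<xi> \<omega>) holomorphic_on UNIV"
proof -
  let ?s = "of_real (sqrt (1 - (cmod \<tau>)\<^sup>2)) :: complex"
  show "(\<lambda>n. \<xi> n \<omega> * (of_real ((1 - (cmod \<tau>)\<^sup>2) powr (1 / 4)) * exp (cnj \<tau> * z\<^sup>2 / 2) *
      (heat_monomial \<tau> n (z * ?s) / of_real (sqrt (fact n))))) sums V_op \<tau> (gaf \<xi> \<omega>) z"
    using sums_mult[OF heat_flow_gaf(2)[of \<xi> \<omega>, OF x \<tau>, of "z * ?s"], of "of_real ((1 - (cmod \<tau>)\<^sup>2) powr (1 / 4)) * exp (cnj \<tau> * z\<^sup>2 / 2)"]
    by (simp add: V_op_def mult_ac)
  have "(heat_flow \<tau> (gaf \<xi> \<omega>) \<circ> (\<lambda>z. z * ?s)) holomorphic_on UNIV"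
    by (intro holomorphic_on_compose holomorphic_intros holomorphic_on_subset[OF heat_flow_gaf(3)[of \<xi> \<omega>, OF x \<tau>]]) auto
  then have "(\<lambda>z. heat_flow \<tau> (gaf \<xi> \<omega>) (z * ?s)) holomorphic_on UNIV" by (simp add: o_def)
  then show "V_op \<tau> (gaf \<xi> \<omega>) holomorphic_on UNIV"
    unfolding V_op_def[abs_def] by (intro holomorphic_intros) auto
qed

text \<open>The right-hand side involves the functions \<eta>_n only through the kernel K, so two
  Gaussian series with the same kernel have the same joint characteristic functions.\<close>

lemma gaussian_series_char:
  fixes \<eta> :: "nat \<Rightarrow> complex \<Rightarrow> complex"
  assumes M: "prob_space M" and iid: "iid_std_complex_gaussian M \<xi>"
    and X: "X \<in> measurable M entire_borel"
    and sX: "\<And>z. AE \<omega> in M. (\<lambda>n. \<xi> n \<omega> * \<eta> n z) sums X \<omega> z"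
    and k: "\<And>z w. (\<lambda>n. \<eta> n z * cnj (\<eta> n w)) sums K z w"
    and J: "finite J"
  shows "(CLINT \<omega>|M. iexp (\<Sum>i\<in>J. t i * coord i (X \<omega>)))
    = of_real (exp (- Re (\<Sum>i\<in>J. \<Sum>j\<in>J. of_real (t i) * (if snd i then 1 else - \<i>) * cnj (of_real (t j) * (if snd j then 1 else - \<i>)) * K (fst i) (fst j)) / 4))"
proof -
  \<comment> \<open>Since Re (- \<i> y) = Im y, this factor makes every real coordinate the real
    part of a complex multiple of a point value.\<close>
  define b where "b i = of_real (t i) * (if snd i then 1 else - \<i>)" for i :: "complex \<times> bool"
  define \<beta> where "\<beta> n = (\<Sum>i\<in>J. b i * \<eta> n (fst i))" for n
  define S where "S \<omega> = (\<Sum>i\<in>J. b i * X \<omega> (fst i))" for \<omega>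
  have Xz [measurable]: "(\<lambda>\<omega>. X \<omega> z) \<in> borel_measurable M" for z
    using measurable_compose[OF X measurable_eval_entire_borel] .
  have "t i * coord i f = Re (b i * f (fst i))" for i f
    by (simp add: b_def coord_def)
  then have "(\<Sum>i\<in>J. t i * coord i (X \<omega>)) = Re (S \<omega>)" for \<omega>
    by (simp add: S_def)
  moreover have "(CLINT \<omega>|M. iexp (Re (S \<omega>))) = of_real (exp (- Re (\<Sum>i\<in>J. \<Sum>j\<in>J. b i * cnj (b j) * K (fst i) (fst j)) / 4))"
  proof (rule iid_char_series[OF M iid])
    have "AE \<omega> in M. \<forall>i\<in>J. (\<lambda>n. \<xi> n \<omega> * \<eta> n (fst i)) sums X \<omega> (fst i)"
      using J sX by (intro AE_finite_allI) auto
    then show "AE \<omega> in M. (\<lambda>n. \<beta> n * \<xi> n \<omega>) sums S \<omega>"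
    proof eventually_elim
      case (elim \<omega>)
      then have "(\<lambda>n. \<Sum>i\<in>J. b i * (\<xi> n \<omega> * \<eta> n (fst i))) sums (\<Sum>i\<in>J. b i * X \<omega> (fst i))"
        by (intro sums_sum sums_mult) auto
      then show ?case by (simp add: \<beta>_def S_def sum_distrib_left mult_ac)
    qed
    show "S \<in> borel_measurable M" unfolding S_def by measurable
    have "(\<lambda>n. \<Sum>i\<in>J. \<Sum>j\<in>J. b i * cnj (b j) * (\<eta> n (fst i) * cnj (\<eta> n (fst j)))) sums (\<Sum>i\<in>J. \<Sum>j\<in>J. b i * cnj (b j) * K (fst i) (fst j))"
      by (intro sums_sum sums_mult k)
    then have "(\<lambda>n. Re (\<Sum>i\<in>J. \<Sum>j\<in>J. b i * cnj (b j) * (\<eta> n (fst i) * cnj (\<eta> n (fst j))))) sums Re (\<Sum>i\<in>J. \<Sum>j\<in>J. b i * cnj (b j) * K (fst i) (fst j))"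
      by (rule sums_Re)
    moreover have "Re (\<Sum>i\<in>J. \<Sum>j\<in>J. b i * cnj (b j) * (\<eta> n (fst i) * cnj (\<eta> n (fst j)))) = (cmod (\<beta> n))\<^sup>2" for n
    proof -
      have "(\<Sum>i\<in>J. \<Sum>j\<in>J. b i * cnj (b j) * (\<eta> n (fst i) * cnj (\<eta> n (fst j)))) = \<beta> n * cnj (\<beta> n)"
        unfolding \<beta>_def cnj_sum sum_product by (simp add: mult_ac)
      also have "\<dots> = of_real ((cmod (\<beta> n))\<^sup>2)" by (rule complex_norm_square[symmetric])
      finally show ?thesis by (simp only: Re_complex_of_real)
    qed
    ultimately show "(\<lambda>n. (cmod (\<beta> n))\<^sup>2) sums Re (\<Sum>i\<in>J. \<Sum>j\<in>J. b i * cnj (b j) * K (fst i) (fst j))"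
      by simp
  qed
  ultimately show ?thesis by (simp only: b_def)
qed

theorem theorem1p1:
  fixes M :: "'a measure" and \<xi> :: "nat \<Rightarrow> 'a \<Rightarrow> complex" and \<tau> :: complex
  assumes "prob_space M"
    and "iid_std_complex_gaussian M \<xi>"
    and "cmod \<tau> < 1"
  shows "(AE \<omega> in M.
            (\<forall>z. summable (\<lambda>n. \<xi> n \<omega> * (z ^ n / of_real (sqrt (fact n))))) \<and>
            gaf \<xi> \<omega> holomorphic_on UNIV \<and>
            (\<forall>z. summable (heat_term \<tau> (gaf \<xi> \<omega>) z)) \<and>
            V_op \<tau> (gaf \<xi> \<omega>) holomorphic_on UNIV) \<and>
         eq_in_law M entire_borel (\<lambda>\<omega>. V_op \<tau> (gaf \<xi> \<omega>)) (gaf \<xi>) \<and>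
         (AE \<omega> in M.
            scale_process (of_real (1 / sqrt (1 - (cmod \<tau>)\<^sup>2)))
              (zero_process (heat_flow \<tau> (gaf \<xi> \<omega>))) =
            zero_process (V_op \<tau> (gaf \<xi> \<omega>))) \<and>
         eq_in_law M point_configurations
           (\<lambda>\<omega>. zero_process (V_op \<tau> (gaf \<xi> \<omega>))) (\<lambda>\<omega>. zero_process (gaf \<xi> \<omega>))"
proof -
  interpret prob_space M by (rule assms(1))
  note iid = assms(1,2) and \<tau> = assms(3)
  note [measurable] = iid_measurable[OF iid]
  define s where "s = sqrt (1 - (cmod \<tau>)\<^sup>2)"
  have s: "s > 0" using \<tau> by (simp add: s_def abs_square_less_1)
  have good: "AE \<omega> in M. linear_growth (\<lambda>n. \<xi> n \<omega>)"
    by (rule iid_AE_linear_growth[OF iid])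
  then obtain N where N: "{\<omega>\<in>space M. \<not> linear_growth (\<lambda>n. \<xi> n \<omega>)} \<subseteq> N" "emeasure M N = 0" and [measurable]: "N \<in> sets M"
    by (rule AE_E)
  have nN: "AE \<omega> in M. \<omega> \<notin> N" using N(2) by (intro AE_not_in) (auto simp: null_sets_def)
  have lg: "linear_growth (\<lambda>n. \<xi> n \<omega>)" if "\<omega> \<in> space M" "\<omega> \<notin> N" for \<omega> using N(1) that by auto
  define \<phi> where "\<phi> n z = z ^ n / of_real (sqrt (fact n))" for n and z :: complex
  define \<psi> where "\<psi> n z = of_real ((1 - (cmod \<tau>)\<^sup>2) powr (1 / 4)) * exp (cnj \<tau> * z\<^sup>2 / 2) *
      (heat_monomial \<tau> n (z * of_real (sqrt (1 - (cmod \<tau>)\<^sup>2))) / of_real (sqrt (fact n)))" for n z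
  \<comment> \<open>\<open>eq_in_law\<close> asks for versions that are measurable and entire for
    every \<omega>, so G and V are set to 0 on a measurable null set N containing all sequences
    without linear growth.\<close>
  define G where "G \<omega> = (if \<omega> \<in> N then (\<lambda>_. 0) else gaf \<xi> \<omega>)" for \<omega>
  define V where "V \<omega> = (if \<omega> \<in> N then (\<lambda>_. 0) else V_op \<tau> (gaf \<xi> \<omega>))" for \<omega>
  have G_sums: "(\<lambda>n. \<xi> n \<omega> * \<phi> n z) sums G \<omega> z" and V_sums: "(\<lambda>n. \<xi> n \<omega> * \<psi> n z) sums V \<omega> z"
    if "\<omega> \<in> space M" "\<omega> \<notin> N" for \<omega> z
    using that(2) gaf_sums[of \<xi> \<omega>, OF lg[OF that]] V_op_gaf(1)[of \<xi> \<omega>, OF lg[OF that] \<tau>]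
    by (simp_all add: G_def V_def \<phi>_def \<psi>_def)
  have meas: "X \<in> measurable M entire_borel"
    if "\<And>\<omega>. \<omega> \<in> space M \<Longrightarrow> X \<omega> holomorphic_on UNIV" "\<And>\<omega>. \<omega> \<in> N \<Longrightarrow> X \<omega> = (\<lambda>_. 0)"
      and sX: "\<And>\<omega> z. \<omega> \<in> space M \<Longrightarrow> \<omega> \<notin> N \<Longrightarrow> (\<lambda>n. \<xi> n \<omega> * \<eta> n z) sums X \<omega> z" for X and \<eta> :: "nat \<Rightarrow> complex \<Rightarrow> complex"
  proof (rule measurable_entire_borelI)
    fix z
    have "(\<lambda>\<omega>. if \<omega> \<in> N then 0 else (\<Sum>n. \<xi> n \<omega> * \<eta> n z)) \<in> borel_measurable M" by measurable
    also have "?this \<longleftrightarrow> (\<lambda>\<omega>. X \<omega> z) \<in> borel_measurable M"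
      using that by (intro measurable_cong) (auto simp: sums_iff)
    finally show "(\<lambda>\<omega>. X \<omega> z) \<in> borel_measurable M" .
  qed (use that in auto)
  have Gm: "G \<in> measurable M entire_borel"
    using gaf_holomorphic[of \<xi>, OF lg] by (intro meas[OF _ _ G_sums]) (auto simp: G_def)
  have Vm: "V \<in> measurable M entire_borel"
    using V_op_gaf(2)[of \<xi>, OF lg \<tau>] by (intro meas[OF _ _ V_sums]) (auto simp: V_def)
  have law: "distr M entire_borel V = distr M entire_borel G"
  proof (rule entire_law_eqI[OF Vm Gm])
    fix J :: "(complex \<times> bool) set" and t :: "complex \<times> bool \<Rightarrow> real"
    assume J: "finite J"
    have sV: "AE \<omega> in M. (\<lambda>n. \<xi> n \<omega> * \<psi> n z) sums V \<omega> z" for z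
      using nN AE_space by eventually_elim (rule V_sums)
    have sG: "AE \<omega> in M. (\<lambda>n. \<xi> n \<omega> * \<phi> n z) sums G \<omega> z" for z
      using nN AE_space by eventually_elim (rule G_sums)
    have kV: "(\<lambda>n. \<psi> n z * cnj (\<psi> n w)) sums exp (z * cnj w)" for z w
      unfolding \<psi>_def by (rule V_op_basis_kernel[OF \<tau>])
    have kG: "(\<lambda>n. \<phi> n z * cnj (\<phi> n w)) sums exp (z * cnj w)" for z w
      unfolding \<phi>_def by (rule gaf_basis_kernel)
    show "(CLINT \<omega>|M. iexp (\<Sum>i\<in>J. t i * coord i (V \<omega>))) = (CLINT \<omega>|M. iexp (\<Sum>i\<in>J. t i * coord i (G \<omega>)))"
      using gaussian_series_char[OF iid Vm sV kV J] gaussian_series_char[OF iid Gm sG kG J] by (rule trans[OF _ sym])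
  qed
  have G0: "AE \<omega> in M. G \<omega> 0 \<noteq> 0"
    using nN iid_AE_nonzero[OF iid, of 0] AE_space
  proof eventually_elim
    case (elim \<omega>)
    have "(\<lambda>n. \<xi> n \<omega> / of_real (sqrt (fact n)) * 0 ^ n) sums (\<xi> 0 \<omega>)"
      using powser_sums_zero[of "\<lambda>n. \<xi> n \<omega> / of_real (sqrt (fact n))"] by simp
    then show ?case
      using G_sums[of \<omega> 0] elim sums_unique2 by (fastforce simp: \<phi>_def)
  qed
  have A: "{f \<in> space entire_borel. f 0 \<noteq> 0} \<in> sets entire_borel" by measurable
  \<comment> \<open>V(0) is an infinite series in the coefficients, unlike G(0) = \<xi>_0; its
    nonvanishing is inherited from G through the equality of laws.\<close>
  have "AE f in distr M entire_borel G. f 0 \<noteq> 0"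
    using G0 by (subst AE_distr_iff[OF Gm A])
  then have V0: "AE \<omega> in M. V \<omega> 0 \<noteq> 0"
    unfolding law[symmetric] by (subst (asm) AE_distr_iff[OF Vm A])
  have 1: "AE \<omega> in M.
            (\<forall>z. summable (\<lambda>n. \<xi> n \<omega> * (z ^ n / of_real (sqrt (fact n))))) \<and>
            gaf \<xi> \<omega> holomorphic_on UNIV \<and>
            (\<forall>z. summable (heat_term \<tau> (gaf \<xi> \<omega>) z)) \<and>
            V_op \<tau> (gaf \<xi> \<omega>) holomorphic_on UNIV"
    using good
  proof eventually_elim
    case (elim \<omega>)
    then show ?case
      using gaf_summable[of \<xi> \<omega>] gaf_holomorphic[of \<xi> \<omega>] heat_flow_gaf(1)[of \<xi> \<omega>] V_op_gaf(2)[of \<xi> \<omega>] \<tau> by blast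
  qed
  have 2: "eq_in_law M entire_borel (\<lambda>\<omega>. V_op \<tau> (gaf \<xi> \<omega>)) (gaf \<xi>)"
    unfolding eq_in_law_def
  proof (intro bexI conjI)
    show "AE \<omega> in M. V_op \<tau> (gaf \<xi> \<omega>) = V \<omega>" using nN by eventually_elim (simp add: V_def)
    show "AE \<omega> in M. gaf \<xi> \<omega> = G \<omega>" using nN by eventually_elim (simp add: G_def)
  qed (rule law Vm Gm)+
  have 3: "AE \<omega> in M. scale_process (of_real (1 / sqrt (1 - (cmod \<tau>)\<^sup>2)))
              (zero_process (heat_flow \<tau> (gaf \<xi> \<omega>))) = zero_process (V_op \<tau> (gaf \<xi> \<omega>))"
    using nN V0 AE_space
  proof eventually_elim
    case (elim \<omega>)
    let ?h = "\<lambda>z. of_real ((1 - (cmod \<tau>)\<^sup>2) powr (1 / 4)) * exp (cnj \<tau> * z\<^sup>2 / 2)"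
    have V: "V_op \<tau> (gaf \<xi> \<omega>) = (\<lambda>z. ?h z * heat_flow \<tau> (gaf \<xi> \<omega>) (z * of_real s))"
      by (simp add: V_op_def s_def fun_eq_iff)
    have "heat_flow \<tau> (gaf \<xi> \<omega>) 0 \<noteq> 0" using elim by (simp add: V_def V)
    moreover have "?h holomorphic_on UNIV" by (intro holomorphic_intros) auto
    moreover have "?h z \<noteq> 0" for z using s by (simp add: s_def)
    ultimately have "scale_process (1 / of_real s) (zero_process (heat_flow \<tau> (gaf \<xi> \<omega>)))
        = zero_process (\<lambda>z. ?h z * heat_flow \<tau> (gaf \<xi> \<omega>) (z * of_real s))"
      using s heat_flow_gaf(3)[of \<xi> \<omega>, OF lg \<tau>] elim by (intro scale_zero_process) auto
    then show ?case by (simp add: V s_def)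
  qed
  have 4: "eq_in_law M point_configurations
           (\<lambda>\<omega>. zero_process (V_op \<tau> (gaf \<xi> \<omega>))) (\<lambda>\<omega>. zero_process (gaf \<xi> \<omega>))"
    unfolding eq_in_law_def
  proof (intro bexI conjI)
    show "AE \<omega> in M. zero_process (V_op \<tau> (gaf \<xi> \<omega>)) = (zero_process' \<circ> V) \<omega>"
      using nN V0 by eventually_elim (auto simp: V_def zero_process'_def fun_eq_iff)
    show "AE \<omega> in M. zero_process (gaf \<xi> \<omega>) = (zero_process' \<circ> G) \<omega>"
      using nN G0 by eventually_elim (auto simp: G_def zero_process'_def fun_eq_iff)
    show "distr M point_configurations (zero_process' \<circ> V) = distr M point_configurations (zero_process' \<circ> G)"
      \<comment> \<open>The laws of the zero processes are the images of the two equal laws under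
        the same measurable map.\<close>
      using arg_cong[OF law, of "\<lambda>L. distr L point_configurations zero_process'"]
      by (simp add: distr_distr measurable_zero_process' Vm Gm)
  qed (rule measurable_comp[OF Vm measurable_zero_process'] measurable_comp[OF Gm measurable_zero_process'])+
  show ?thesis using 1 2 3 4 by blast
qed

end
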